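(* Let $d\geq 1$ be an integer, let $q\geq 1$ be real, and let $\rho$ be a Borel probability measure on $\mathbb{R}^{d}$ with $\int\|x\|^{q}\rho(dx)<+\infty$. For every integer $n\geq 1$, there exist points $x_{1},\dots,x_{n}\in\mathbb{R}^{d}$ (depending on $n$), with associated empirical measure $\mu^{(n)}=n^{-1}\sum_{k=1}^{n}\delta_{x_{k}}$, such that for all real $p$ with $1\leq p<q$, $$W_{p}(\mu^{(n)},\rho)=o\left(f_{p,d}(n)^{1-p/q}\right)\qquad\text{as } n\to+\infty.$$
   Context: $\mathbb{R}^{d}$ is equipped with the maximum norm $\|\cdot\|$. For $p\geq 1$ and Borel probability measures $\rho,\mu$ on $\mathbb{R}^{d}$ with finite $p$-th moment ($\int\|x\|^{p}\rho(dx)<+\infty$, and likewise for $\mu$), the Wasserstein distance of order $p$ is $$W_{p}(\rho,\mu):=\left(\inf_{\pi}\int_{(\mathbb{R}^{d})^{2}}\|x-y\|^{p}\,\pi(dx,dy)\right)^{1/p},$$ where the infimum is over all couplings $\pi$ of $\rho$ and $\mu$. For real $p\geq 1$ and integers $d,n\geq 1$, define: $f_{p,d}(n):=\left(\frac{d}{d-p}\right)^{1/p}n^{-1/d}$ if $p<d$; $f_{p,d}(n):=\left(\frac{1+\ln n}{n}\right)^{1/d}$ if $p=d$; $f_{p,d}(n):=\zeta(p/d)\,n^{-1/p}$ if $p>d$, where $\zeta$ is the Riemann zeta function. *)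

theory Defs
  imports "HOL-Probability.Probability" "HOL-Library.Landau_Symbols"
begin

definition coupling :: "(real ^ 'd) measure \<Rightarrow> (real ^ 'd) measure \<Rightarrow>
    ((real ^ 'd) \<times> (real ^ 'd)) measure \<Rightarrow> bool" where
  "coupling \<rho> \<mu> \<pi> \<longleftrightarrow> sets \<pi> = sets (borel \<Otimes>\<^sub>M borel) \<and> prob_space \<pi> \<and>
     distr \<pi> borel fst = \<rho> \<and> distr \<pi> borel snd = \<mu>"

definition transport_cost :: "real \<Rightarrow> (real ^ 'd) measure \<Rightarrow> (real ^ 'd) measure \<Rightarrow> ennreal" where
  "transport_cost p \<rho> \<mu> =
     (INF \<pi> \<in> Collect (coupling \<rho> \<mu>). \<integral>\<^sup>+ (x, y). ennreal (infnorm (x - y) powr p) \<partial>\<pi>)"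

text \<open>
  The norm is the maximum norm \<open>infnorm\<close>.  The conversion \<open>enn2real\<close> sends \<open>\<infinity>\<close> to \<open>0\<close>,
  which does no harm for measures with finite \<open>p\<close>-th moment: the optimal cost is then finite, see
  \<open>transport_cost_finite\<close> below.
\<close>

definition wasserstein :: "real \<Rightarrow> (real ^ 'd) measure \<Rightarrow> (real ^ 'd) measure \<Rightarrow> real" where
  "wasserstein p \<rho> \<mu> = enn2real (transport_cost p \<rho> \<mu>) powr (1 / p)"

definition empirical_measure :: "nat \<Rightarrow> (nat \<Rightarrow> real ^ 'd) \<Rightarrow> (real ^ 'd) measure" where
  "empirical_measure n x =
     measure_of UNIV (sets borel) (\<lambda>A. (\<Sum>k=1..n. emeasure (return borel (x k)) A) / of_nat n)"

text \<open>The Riemann zeta function as its Dirichlet series; only used for \<open>s > 1\<close>.\<close>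

definition riemann_zeta :: "real \<Rightarrow> real" where
  "riemann_zeta s = (\<Sum>k. 1 / real (Suc k) powr s)"

definition rate :: "real \<Rightarrow> nat \<Rightarrow> nat \<Rightarrow> real" where
  "rate p d n =
     (if p < real d then (real d / (real d - p)) powr (1 / p) * real n powr (- 1 / real d)
      else if p = real d then ((1 + ln (real n)) / real n) powr (1 / real d)
      else riemann_zeta (p / real d) * real n powr (- 1 / p))"

lemma sets_empirical_measure [simp]: "sets (empirical_measure n (x :: nat \<Rightarrow> real ^ 'd)) = sets borel"
  unfolding empirical_measure_def
  using sets.sigma_sets_eq[of "borel :: (real ^ 'd) measure"] by (simp add: sets_measure_of)

lemma emeasure_empirical_measure:
  assumes "A \<in> sets borel"
  shows "emeasure (empirical_measure n x) A =
    (\<Sum>k=1..n. emeasure (return borel (x k)) A) / of_nat n"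
proof (rule emeasure_measure_of[OF empirical_measure_def])
  show "sets borel \<subseteq> Pow (UNIV :: (real ^ 'a) set)" by simp
  show "A \<in> sets (empirical_measure n x)" using assms by simp
  show "positive (sets (empirical_measure n x))
     (\<lambda>A. (\<Sum>k=1..n. emeasure (return borel (x k)) A) / of_nat n)"
    by (simp add: positive_def)
  show "countably_additive (sets (empirical_measure n x))
     (\<lambda>A. (\<Sum>k=1..n. emeasure (return borel (x k)) A) / of_nat n)"
  proof (rule countably_additiveI)
    fix B :: "nat \<Rightarrow> (real ^ 'a) set"
    assume B: "range B \<subseteq> sets (empirical_measure n x)" "disjoint_family B"
    have "(\<Sum>i. (\<Sum>k=1..n. emeasure (return borel (x k)) (B i)) / of_nat n)
        = (\<Sum>i. (\<Sum>k=1..n. emeasure (return borel (x k)) (B i))) / of_nat n"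
      by (simp add: divide_ennreal_def)
    also have "(\<Sum>i. (\<Sum>k=1..n. emeasure (return borel (x k)) (B i)))
        = (\<Sum>k=1..n. (\<Sum>i. emeasure (return borel (x k)) (B i)))"
      by (rule suminf_sum) auto
    also have "\<dots> = (\<Sum>k=1..n. emeasure (return borel (x k)) (\<Union> (range B)))"
      using B by (intro sum.cong refl suminf_emeasure) auto
    finally show "(\<Sum>i. (\<Sum>k=1..n. emeasure (return borel (x k)) (B i)) / of_nat n)
        = (\<Sum>k=1..n. emeasure (return borel (x k)) (\<Union> (range B))) / of_nat n" .
  qed
qed

lemma transport_cost_finite:
  fixes \<rho> \<mu> :: "(real ^ 'd) measure"
  assumes p: "p \<ge> 1"
    and \<rho>: "prob_space \<rho>" "sets \<rho> = sets borel" "integrable \<rho> (\<lambda>x. infnorm x powr p)"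
    and \<mu>: "prob_space \<mu>" "sets \<mu> = sets borel" "integrable \<mu> (\<lambda>x. infnorm x powr p)"
  shows "transport_cost p \<rho> \<mu> < \<infinity>"
proof -
  interpret R: prob_space \<rho> by fact
  interpret M: prob_space \<mu> by fact
  interpret P: pair_prob_space \<rho> \<mu> ..
  let ?P = "\<rho> \<Otimes>\<^sub>M \<mu>"
  note [measurable_cong] = \<rho>(2) \<mu>(2)
  have infnorm_meas [measurable]: "infnorm \<in> borel_measurable (borel :: (real ^ 'd) measure)"
    by (intro borel_measurable_continuous_onI continuous_intros)
  have d1: "distr ?P \<rho> fst = \<rho>"
    by (rule M.distr_pair_fst)
  have d2: "distr ?P \<mu> snd = \<mu>"
  proof (rule measure_eqI)
    fix A assume "A \<in> sets (distr ?P \<mu> snd)"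
    then have A: "A \<in> sets \<mu>" by simp
    then have "snd -` A \<inter> space ?P = space \<rho> \<times> A"
      using sets.sets_into_space[OF A] by (auto simp: space_pair_measure)
    then show "emeasure (distr ?P \<mu> snd) A = emeasure \<mu> A"
      using A by (simp add: emeasure_distr M.emeasure_pair_measure_Times R.emeasure_space_1)
  qed simp
  have c: "coupling \<rho> \<mu> ?P"
    unfolding coupling_def
  proof (intro conjI)
    show "sets ?P = sets (borel \<Otimes>\<^sub>M borel)"
      by (rule sets_pair_measure_cong) (use \<rho> \<mu> in auto)
    show "prob_space ?P" by (rule P.prob_space_axioms)
    show "distr ?P borel fst = \<rho>"
      using d1 by (metis distr_cong \<rho>(2))
    show "distr ?P borel snd = \<mu>"
      using d2 by (metis distr_cong \<mu>(2))
  qed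
  have bound: "infnorm (x - y) powr p \<le> 2 powr p * (infnorm x powr p + infnorm y powr p)"
    for x y :: "real ^ 'd"
  proof -
    have "infnorm (x - y) \<le> infnorm x + infnorm y"
      by (metis infnorm_triangle infnorm_neg diff_conv_add_uminus)
    also have "\<dots> \<le> 2 * max (infnorm x) (infnorm y)" by linarith
    finally have "infnorm (x - y) powr p \<le> (2 * max (infnorm x) (infnorm y)) powr p"
      using p by (intro powr_mono2) (auto simp: infnorm_pos_le)
    also have "\<dots> = 2 powr p * max (infnorm x) (infnorm y) powr p"
      by (simp add: powr_mult infnorm_pos_le le_max_iff_disj)
    also have "\<dots> \<le> 2 powr p * (infnorm x powr p + infnorm y powr p)"
      by (intro mult_left_mono) (auto simp: max_def)
    finally show ?thesis .
  qed
  have "transport_cost p \<rho> \<mu> \<le> (\<integral>\<^sup>+ (x, y). ennreal (infnorm (x - y) powr p) \<partial>?P)"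
    unfolding transport_cost_def using c by (intro INF_lower) auto
  also have "\<dots> \<le> (\<integral>\<^sup>+ z. ennreal (2 powr p) *
      (ennreal (infnorm (fst z) powr p) + ennreal (infnorm (snd z) powr p)) \<partial>?P)"
    using bound by (intro nn_integral_mono)
      (auto simp: ennreal_mult[symmetric] ennreal_plus[symmetric] simp del: ennreal_plus
        intro!: ennreal_leI)
  also have "\<dots> = ennreal (2 powr p) * ((\<integral>\<^sup>+ z. ennreal (infnorm (fst z) powr p) \<partial>?P)
      + (\<integral>\<^sup>+ z. ennreal (infnorm (snd z) powr p) \<partial>?P))"
    by (subst nn_integral_cmult, measurable) (subst nn_integral_add, measurable)
  also have "(\<integral>\<^sup>+ z. ennreal (infnorm (fst z) powr p) \<partial>?P)
      = (\<integral>\<^sup>+ x. ennreal (infnorm x powr p) \<partial>distr ?P \<rho> fst)"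
    by (subst nn_integral_distr) auto
  also have "(\<integral>\<^sup>+ z. ennreal (infnorm (snd z) powr p) \<partial>?P)
      = (\<integral>\<^sup>+ x. ennreal (infnorm x powr p) \<partial>distr ?P \<mu> snd)"
    by (subst nn_integral_distr) auto
  also have "ennreal (2 powr p) * ((\<integral>\<^sup>+ x. ennreal (infnorm x powr p) \<partial>distr ?P \<rho> fst) +
      (\<integral>\<^sup>+ x. ennreal (infnorm x powr p) \<partial>distr ?P \<mu> snd)) < \<infinity>"
    unfolding d1 d2 using \<rho>(3) \<mu>(3)
    by (auto simp: nn_integral_eq_integral ennreal_mult_less_top ennreal_add_less_top)
  finally show ?thesis .
qed

end

theory Submission
  imports Defs
begin

text \<open>
  Order the points of \<open>\<real>\<^sup>d\<close> along a multiscale curve, cut \<open>\<rho>\<close> along this order into \<open>n\<close>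
  consecutive pieces of mass \<open>1/n\<close>, and transport each piece to one point that comes no later in
  the order than any point of the piece.  Neither the cutting nor the points depend on \<open>p\<close>, which
  is how a single family of points serves all \<open>p < q\<close>.

  The order comes from a key \<open>\<kappa> : \<real>\<^sup>d \<rightarrow> \<nat>\<close> of Morton type (\<open>ex_key\<close>).  Coordinates are rounded to
  multiples of \<open>3\<^sup>-\<^sup>n\<close> and written in balanced ternary, and the \<open>d\<close> digits of a given position form
  one digit of \<open>\<kappa>\<close> in base \<open>B = 3\<^sup>d\<close>.  Deleting the last \<open>l\<close> digits of the key amounts to passing to
  the cell of side \<open>3\<^sup>l\<^sup>-\<^sup>n\<close> that contains the point, so every cell of every level is an interval of
  keys.  Because the digits are balanced, the cells around the origin are concentric cubes, and
  these are initial segments of the order.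

  Fix a radius \<open>3\<^sup>J\<close>.  Inside the corresponding cube, a piece of mass \<open>1/n\<close> costs at most
  \<open>diameter\<^sup>p / n\<close>, where the diameter is that of the smallest cell containing the piece.
  A piece is not contained in a cell of side \<open>3\<^sup>J\<^sup>-\<^sup>s\<close> only if it straddles one of the boundaries
  between cells of that side, of which there are fewer than \<open>3\<^sup>d\<^sup>s\<close>; different pieces straddle
  different boundaries (\<open>straddled_pieces_card\<close>).  The cost inside the cube is therefore at most a
  constant times \<open>3\<^sup>J\<^sup>p \<Sum>\<^sub>s 3\<^sup>-\<^sup>p\<^sup>s min (1, 3\<^sup>d\<^sup>s/n)\<close>, and this sum is \<open>O(rate\<^sup>p)\<close>
  (\<open>multiscale_sum_le_rate\<close>): it is dominated by its terms near \<open>3\<^sup>d\<^sup>s = n\<close> if \<open>p < d\<close> and by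
  \<open>s = 0\<close> if \<open>p > d\<close>, and it has about \<open>log n\<close> equal leading terms if \<open>p = d\<close>.  Outside the cube, \<open>x\<close> and
  its image lie in a common centred cube of size comparable to \<open>x\<close>, so the cost is at most a constant
  times the \<open>p\<close>-th moment of \<open>\<rho>\<close> there, hence times \<open>3\<^sup>J\<^sup>(\<^sup>p\<^sup>-\<^sup>q\<^sup>) \<tau>(J)\<close> with \<open>\<tau>(J) \<rightarrow> 0\<close> since the
  \<open>q\<close>-th moment is finite.  This gives \<open>quantization_cost_bound\<close>, and taking \<open>3\<^sup>J\<close> close to a small
  multiple of \<open>rate\<^sup>-\<^sup>p\<^sup>/\<^sup>q\<close> balances the two terms (\<open>eventually_le_balanced\<close>).
\<close>

section \<open>Couplings from fractional assignments\<close>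

lemma borel_measurable_infnorm [measurable]: "infnorm \<in> borel_measurable (borel :: (real ^ 'd) measure)"
  by (intro borel_measurable_continuous_onI continuous_intros)

lemma nn_integral_count_space_pair:
  fixes \<rho> :: "'a measure"
  assumes "sigma_finite_measure \<rho>" "finite K"
    and f: "\<And>k. k \<in> K \<Longrightarrow> (\<lambda>x. f (k, x)) \<in> borel_measurable \<rho>"
  shows "(\<integral>\<^sup>+ z. f z \<partial>(count_space K \<Otimes>\<^sub>M \<rho>)) = (\<Sum>k\<in>K. \<integral>\<^sup>+ x. f (k, x) \<partial>\<rho>)"
proof -
  interpret sigma_finite_measure \<rho> by fact
  have "f \<in> borel_measurable (count_space K \<Otimes>\<^sub>M \<rho>)"
    using f \<open>finite K\<close> by (intro measurable_pair_measure_countable1) (auto intro: countable_finite)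
  from nn_integral_fst[OF this] show ?thesis
    using \<open>finite K\<close> by (simp add: nn_integral_count_space_finite)
qed

text \<open>
  A fractional assignment of the mass at \<open>x\<close> to the points \<open>y 1, \<dots>, y n\<close>, with share \<open>w k x\<close> for
  \<open>y k\<close>, is a coupling as soon as every point receives mass \<open>1/n\<close>.  Fractional shares are needed
  because an atom of \<open>\<rho>\<close> may have to be divided among several points.
\<close>

lemma transport_cost_le_weights:
  fixes \<rho> :: "(real ^ 'd) measure" and y :: "nat \<Rightarrow> real ^ 'd" and w :: "nat \<Rightarrow> real ^ 'd \<Rightarrow> ennreal"
  assumes \<rho>: "prob_space \<rho>" "sets \<rho> = sets borel" and n: "n > 0"
    and w[measurable]: "\<And>k. w k \<in> borel_measurable borel"
    and part: "\<And>x. (\<Sum>k=1..n. w k x) = 1"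
    and mass: "\<And>k. k \<in> {1..n} \<Longrightarrow> (\<integral>\<^sup>+ x. w k x \<partial>\<rho>) = 1 / of_nat n"
  shows "transport_cost p (empirical_measure n y) \<rho>
    \<le> (\<Sum>k=1..n. \<integral>\<^sup>+ x. w k x * ennreal (infnorm (y k - x) powr p) \<partial>\<rho>)"
proof -
  interpret prob_space \<rho> by fact
  note [measurable_cong] = \<rho>(2)
  let ?Q = "count_space {1..n} \<Otimes>\<^sub>M \<rho>"
  have W[measurable]: "(\<lambda>(k, x). w k x) \<in> borel_measurable ?Q"
    by (intro measurable_pair_measure_countable1) auto
  have Y[measurable]: "(\<lambda>(k, x). (y k, x)) \<in> ?Q \<rightarrow>\<^sub>M borel \<Otimes>\<^sub>M borel"
    by (intro measurable_pair_measure_countable1) auto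
  \<comment> \<open>the law of \<open>(y K, X)\<close>, where \<open>X\<close> has law \<open>\<rho>\<close> and \<open>K = k\<close> with conditional probability \<open>w k X\<close>\<close>
  define \<pi> where "\<pi> = distr (density ?Q (\<lambda>(k, x). w k x)) (borel \<Otimes>\<^sub>M borel) (\<lambda>(k, x). (y k, x))"
  have sets\<pi>[measurable_cong, simp]: "sets \<pi> = sets (borel \<Otimes>\<^sub>M borel)" by (simp add: \<pi>_def)
  have integ: "(\<integral>\<^sup>+ z. f z \<partial>\<pi>) = (\<Sum>k=1..n. \<integral>\<^sup>+ x. w k x * f (y k, x) \<partial>\<rho>)"
    if [measurable]: "f \<in> borel_measurable (borel \<Otimes>\<^sub>M borel)" for f
  proof -
    have fY: "(\<lambda>z. f ((\<lambda>(k, x). (y k, x)) z)) \<in> borel_measurable ?Q"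
      using Y that by (rule measurable_compose)
    have "(\<integral>\<^sup>+ z. f z \<partial>\<pi>) = (\<integral>\<^sup>+ z. f ((\<lambda>(k, x). (y k, x)) z) \<partial>density ?Q (\<lambda>(k, x). w k x))"
      unfolding \<pi>_def
      by (rule nn_integral_distr)
        (subst measurable_cong_sets[OF sets_density refl], rule Y, subst measurable_cong_sets[OF sets_distr refl], rule that)
    also have "\<dots> = (\<integral>\<^sup>+ z. (\<lambda>(k, x). w k x) z * f ((\<lambda>(k, x). (y k, x)) z) \<partial>?Q)"
      by (rule nn_integral_density[OF W fY])
    also have "\<dots> = (\<Sum>k=1..n. \<integral>\<^sup>+ x. w k x * f (y k, x) \<partial>\<rho>)"
      by (subst nn_integral_count_space_pair) (auto intro: sigma_finite_measure_axioms)
    finally show ?thesis .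
  qed
  have "(\<integral>\<^sup>+ z. 1 \<partial>\<pi>) = (\<Sum>k=1..n. 1 / of_nat n :: ennreal)"
    by (subst integ) (auto simp: mass)
  also have "\<dots> = 1"
    using n by (simp add: ennreal_times_divide) (auto intro!: ennreal_divide_self simp: of_nat_less_top)
  finally have "prob_space \<pi>"
    by (intro prob_spaceI) simp
  moreover have "distr \<pi> borel fst = empirical_measure n y"
  proof (rule measure_eqI)
    fix A assume "A \<in> sets (distr \<pi> borel fst)"
    then have [measurable]: "A \<in> sets borel" by simp
    have "emeasure (distr \<pi> borel fst) A = (\<integral>\<^sup>+ z. indicator A z \<partial>distr \<pi> borel fst)"
      by simp
    also have "\<dots> = (\<integral>\<^sup>+ z. indicator A (fst z) \<partial>\<pi>)"
      by (rule nn_integral_distr) auto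
    also have "\<dots> = (\<Sum>k=1..n. \<integral>\<^sup>+ x. w k x * indicator A (y k) \<partial>\<rho>)"
      by (subst integ) auto
    also have "\<dots> = (\<Sum>k=1..n. indicator A (y k) / of_nat n)"
      by (intro sum.cong refl) (simp add: nn_integral_multc mass divide_ennreal_def mult.commute)
    also have "\<dots> = emeasure (empirical_measure n y) A"
      by (simp add: emeasure_empirical_measure divide_ennreal_def sum_distrib_right)
    finally show "emeasure (distr \<pi> borel fst) A = emeasure (empirical_measure n y) A" .
  qed simp
  moreover have "distr \<pi> borel snd = \<rho>"
  proof (rule measure_eqI)
    fix A assume "A \<in> sets (distr \<pi> borel snd)"
    then have [measurable]: "A \<in> sets borel" by simp
    have "emeasure (distr \<pi> borel snd) A = (\<integral>\<^sup>+ z. indicator A z \<partial>distr \<pi> borel snd)"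
      by simp
    also have "\<dots> = (\<integral>\<^sup>+ z. indicator A (snd z) \<partial>\<pi>)"
      by (rule nn_integral_distr) auto
    also have "\<dots> = (\<Sum>k=1..n. \<integral>\<^sup>+ x. w k x * indicator A x \<partial>\<rho>)"
      by (subst integ) auto
    also have "\<dots> = (\<integral>\<^sup>+ x. (\<Sum>k=1..n. w k x) * indicator A x \<partial>\<rho>)"
      by (subst nn_integral_sum[symmetric]) (auto simp: sum_distrib_right)
    also have "\<dots> = emeasure \<rho> A"
      by (simp only: part) (simp add: \<rho>(2))
    finally show "emeasure (distr \<pi> borel snd) A = emeasure \<rho> A" .
  qed (simp add: \<rho>)
  ultimately have "coupling (empirical_measure n y) \<rho> \<pi>"
    by (simp add: coupling_def)
  then have "transport_cost p (empirical_measure n y) \<rho>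
      \<le> (\<integral>\<^sup>+ (x, y). ennreal (infnorm (x - y) powr p) \<partial>\<pi>)"
    unfolding transport_cost_def by (intro INF_lower) auto
  also have "\<dots> = (\<Sum>k=1..n. \<integral>\<^sup>+ x. w k x * ennreal (infnorm (y k - x) powr p) \<partial>\<rho>)"
    by (subst integ) auto
  finally show ?thesis .
qed

section \<open>Cutting a law into pieces of equal mass\<close>

text \<open>
  The length of the part of \<open>[(k - 1)/n, k/n]\<close> below \<open>s\<close>.  Along the distribution function of a law
  it counts the mass that the \<open>k\<close>-th piece has collected so far.
\<close>

definition piece :: "nat \<Rightarrow> nat \<Rightarrow> real \<Rightarrow> real" where
  "piece n k s = min (1 / real n) (max 0 (s - real (k - 1) / real n))"

lemma piece_eq: assumes "n > 0" "k \<ge> 1" 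
  shows "piece n k s = max (real (k-1) / n) (min (real k / n) s) - real (k-1) / n"
proof -
  have "real (k-1) / n + 1 / n = real k / n"
    using assms by (simp add: of_nat_diff add_divide_distrib[symmetric])
  moreover have "1 / real n > 0" using assms by simp
  ultimately show ?thesis unfolding piece_def by linarith
qed

lemma sum_piece:
  assumes "n > 0" "0 \<le> s" "s \<le> 1"
  shows "(\<Sum>k=1..n. piece n k s) = s"
proof -
  have "(\<Sum>k=1..m. piece n k s) = min (real m / n) s" for m
  proof (induction m)
    case 0 then show ?case using assms by simp
  next
    case (Suc m)
    have "real m / n \<le> real (Suc m) / n" by (simp add: divide_right_mono)
    then show ?case using Suc piece_eq[OF \<open>n > 0\<close>, of "Suc m" s] by (simp del: of_nat_Suc) 
  qed
  from this[of n] assms show ?thesis by simp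
qed

lemma nn_integral_nat_valued:
  assumes [measurable]: "\<kappa> \<in> M \<rightarrow>\<^sub>M count_space (UNIV :: nat set)"
  shows "(\<integral>\<^sup>+ x. f (\<kappa> x) \<partial>M) = (\<Sum>i. f i * emeasure M {x \<in> space M. \<kappa> x = i})"
proof -
  have "(\<integral>\<^sup>+ x. f (\<kappa> x) \<partial>M) = (\<integral>\<^sup>+ x. (\<Sum>i. f i * indicator {x \<in> space M. \<kappa> x = i} x) \<partial>M)"
  proof (rule nn_integral_cong)
    fix x assume "x \<in> space M"
    then have "(\<Sum>i. f i * indicator {x \<in> space M. \<kappa> x = i} x) = (\<Sum>i\<in>{\<kappa> x}. f i * indicator {x \<in> space M. \<kappa> x = i} x)"
      by (intro suminf_finite) auto
    with \<open>x \<in> space M\<close> show "f (\<kappa> x) = (\<Sum>i. f i * indicator {x \<in> space M. \<kappa> x = i} x)" by simp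
  qed
  also have "\<dots> = (\<Sum>i. f i * emeasure M {x \<in> space M. \<kappa> x = i})"
    by (subst nn_integral_suminf) (auto simp: nn_integral_cmult)
  finally show ?thesis .
qed

text \<open>
  Lay the masses of \<open>\<kappa> = 0, 1, 2, \<dots>\<close> one after the other on the unit interval, so that value \<open>i\<close>
  occupies \<open>[F i, F (i + 1)]\<close>.  The share of piece \<open>k\<close> at \<open>i\<close> is the proportion of this interval that
  lies in \<open>[(k - 1)/n, k/n]\<close>.  If the piece uses two values on different sides of \<open>b\<close>, the boundary
  point \<open>F b\<close> lies strictly inside \<open>[(k - 1)/n, k/n]\<close>; this is what allows counting the pieces that
  straddle a boundary.
\<close>

lemma (in prob_space) chop_law:
  fixes \<kappa> :: "'a \<Rightarrow> nat"
  assumes \<kappa>[measurable]: "\<kappa> \<in> M \<rightarrow>\<^sub>M count_space UNIV" and n: "n > 0"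
  defines "F \<equiv> \<lambda>i. measure M {x \<in> space M. \<kappa> x < i}"
  obtains w :: "nat \<Rightarrow> nat \<Rightarrow> real" and first :: "nat \<Rightarrow> nat"
  where "\<And>k i. 0 \<le> w k i" "\<And>i. (\<Sum>k=1..n. w k i) = 1"
    "\<And>k. k \<in> {1..n} \<Longrightarrow> (\<integral>\<^sup>+ x. w k (\<kappa> x) \<partial>M) = ennreal (1 / n)"
    "\<And>k. k \<in> {1..n} \<Longrightarrow> \<exists>x \<in> space M. \<kappa> x = first k"
    "AE x in M. \<forall>k\<in>{1..n}. w k (\<kappa> x) > 0 \<longrightarrow> first k \<le> \<kappa> x \<and>
       (\<forall>b. first k < b \<and> b \<le> \<kappa> x \<longrightarrow> real (k - 1) / n < F b \<and> F b < real k / n)"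
proof -
  define a where "a i = measure M {x \<in> space M. \<kappa> x = i}" for i
  have FS: "F (Suc i) = F i + a i" for i
    unfolding F_def a_def
    by (subst finite_measure_Union[symmetric]) (auto intro!: arg_cong[where f = "measure M"])
  have a0: "a i \<ge> 0" for i by (simp add: a_def)
  have monoF: "mono F" by (rule mono_iff_le_Suc[THEN iffD2]) (simp add: FS a0)
  have F0: "F 0 = 0" by (simp add: F_def)
  have F01: "0 \<le> F i" "F i \<le> 1" for i by (auto simp: F_def)
  have limF: "F \<longlonglongrightarrow> 1"
  proof -
    have "(\<lambda>i. measure M {x \<in> space M. \<kappa> x < i}) \<longlonglongrightarrow> measure M (\<Union>i. {x \<in> space M. \<kappa> x < i})"
      by (intro finite_Lim_measure_incseq) (auto simp: incseq_def)
    also have "(\<Union>i. {x \<in> space M. \<kappa> x < i}) = space M" by auto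
    finally show ?thesis by (simp add: F_def prob_space)
  qed
  \<comment> \<open>the value at null atoms only has to make the shares sum to one\<close>
  define w where "w k i = (if a i = 0 then 1 / n else (piece n k (F (Suc i)) - piece n k (F i)) / a i)" for k i
  have pmono: "piece n k s \<le> piece n k t" if "s \<le> t" for k s t
    using that by (auto simp: piece_def)
  have w0: "0 \<le> w k i" for k i
    using pmono[of "F i" "F (Suc i)" k] a0[of i] by (auto simp: w_def FS)
  have wsum: "(\<Sum>k=1..n. w k i) = 1" for i
  proof (cases "a i = 0")
    case True then show ?thesis using n by (simp add: w_def)
  next
    case False
    then have "(\<Sum>k=1..n. w k i) = ((\<Sum>k=1..n. piece n k (F (Suc i))) - (\<Sum>k=1..n. piece n k (F i))) / a i"
      by (simp add: w_def sum_divide_distrib sum_subtractf diff_divide_distrib)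
    also have "\<dots> = 1" unfolding sum_piece[OF n F01] using False by (simp add: FS)
    finally show ?thesis .
  qed
  have wint: "(\<integral>\<^sup>+ x. w k (\<kappa> x) \<partial>M) = ennreal (1 / n)" if k: "k \<in> {1..n}" for k
  proof -
    have pos: "0 < 1 / real n" using n by simp
    have "real k / n = real (k-1) / n + 1 / n" 
      using k by (simp add: of_nat_diff add_divide_distrib[symmetric])
    moreover have "real k / n \<le> 1" using k by simp
    ultimately have p1: "piece n k 1 = 1 / n" using pos unfolding piece_def by linarith
    have p0: "piece n k 0 = 0" using pos by (auto simp: piece_def)
    have "(\<lambda>i. piece n k (F i)) \<longlonglongrightarrow> piece n k 1"
      unfolding piece_def by (intro tendsto_intros limF)
    then have "(\<lambda>i. piece n k (F (Suc i)) - piece n k (F i)) sums (piece n k 1 - piece n k (F 0))"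
      by (rule telescope_sums)
    moreover have "w k i * a i = piece n k (F (Suc i)) - piece n k (F i)" for i
      by (cases "a i = 0") (simp_all add: w_def FS)
    ultimately have S: "(\<lambda>i. w k i * a i) sums (1 / n)"
      by (simp add: p1 p0 F0)
    have "(\<integral>\<^sup>+ x. w k (\<kappa> x) \<partial>M) = (\<Sum>i. ennreal (w k i) * emeasure M {x \<in> space M. \<kappa> x = i})"
      by (rule nn_integral_nat_valued) fact
    also have "\<dots> = (\<Sum>i. ennreal (w k i * a i))"
      using w0 a0 by (simp add: emeasure_eq_measure a_def ennreal_mult)
    also have "\<dots> = ennreal (1 / n)"
      by (intro suminf_ennreal_eq S mult_nonneg_nonneg w0 a0)
    finally show ?thesis .
  qed
  define first where "first k = (LEAST i. real (k - 1) / n < F (Suc i))" for k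
  have ex: "\<exists>i. real (k - 1) / n < F (Suc i)" if "k \<in> {1..n}" for k
  proof -
    have "real (k - 1) / n < 1" using that by simp
    from order_tendstoD(1)[OF LIMSEQ_Suc[OF limF] this] show ?thesis
      by (auto simp: eventually_sequentially)
  qed
  have first: "real (k - 1) / n < F (Suc (first k))" if "k \<in> {1..n}" for k
    unfolding first_def using ex[OF that] by (rule LeastI_ex)
  have "\<exists>x \<in> space M. \<kappa> x = first k" if "k \<in> {1..n}" for k
  proof (rule ccontr)
    assume "\<not> ?thesis"
    then have "{x \<in> space M. \<kappa> x = first k} = {}" by blast
    then have "a (first k) = 0" unfolding a_def by (simp only: measure_empty)
    then have *: "real (k - 1) / n < F (first k)" using first[OF that] by (simp add: FS)
    show False
    proof (cases "first k")
      case 0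
      have "0 \<le> real (k - 1) / n" by (rule divide_nonneg_nonneg) simp_all
      then show False using *[unfolded 0 F0] by linarith
    next
      case (Suc i)
      then have "first k \<le> i" using * unfolding first_def[of k] by (intro Least_le) simp
      then show False using Suc by simp
    qed
  qed
  moreover have "AE x in M. \<forall>k\<in>{1..n}. w k (\<kappa> x) > 0 \<longrightarrow> first k \<le> \<kappa> x \<and>
       (\<forall>b. first k < b \<and> b \<le> \<kappa> x \<longrightarrow> real (k - 1) / n < F b \<and> F b < real k / n)"
  proof -
    have "AE x in M. \<kappa> x = i \<longrightarrow> a i \<noteq> 0" for i
    proof (cases "a i = 0")
      case True
      then have "{x \<in> space M. \<kappa> x = i} \<in> null_sets M" by (auto simp: a_def emeasure_eq_measure)
      then show ?thesis by (rule AE_I') auto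
    qed simp
    then have "AE x in M. \<forall>i. \<kappa> x = i \<longrightarrow> a i \<noteq> 0" unfolding AE_all_countable by blast
    then show ?thesis
    proof (rule AE_mp, intro AE_I2 impI ballI)
      fix x k assume ax: "\<forall>i. \<kappa> x = i \<longrightarrow> a i \<noteq> 0" and k: "k \<in> {1..n}" and wp: "w k (\<kappa> x) > 0"
      let ?i = "\<kappa> x"
      have "piece n k (F ?i) < piece n k (F (Suc ?i))"
        using wp ax a0[of ?i] by (auto simp: w_def zero_less_divide_iff split: if_splits)
      moreover have "real (k-1) / n \<le> real k / n" by (simp add: divide_right_mono)
      ultimately have A: "real (k - 1) / n < F (Suc ?i)" "F ?i < real k / n"
        using piece_eq[OF n, of k] k by auto
      have "real (k - 1) / n < F b \<and> F b < real k / n" if "first k < b" "b \<le> ?i" for b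
        using monoD[OF monoF, of "Suc (first k)" b] monoD[OF monoF, of b ?i] first[OF k] A(2) that
        by simp
      moreover have "first k \<le> ?i" unfolding first_def using A(1) by (rule Least_le)
      ultimately show "first k \<le> ?i \<and> (\<forall>b. first k < b \<and> b \<le> ?i \<longrightarrow> real (k - 1) / n < F b \<and> F b < real k / n)"
        by blast
    qed
  qed
  ultimately show thesis using that w0 wsum wint by blast
qed

section \<open>A balanced ternary Morton key\<close>

text \<open>
  The zero vector must receive code 0 so that leading zero digits leave the key unchanged.
\<close>

lemma ex_digit_code:
  "\<exists>e :: ('d::finite \<Rightarrow> int) \<Rightarrow> nat. inj_on e {v. \<forall>j. v j \<in> {0..2}} \<and>
     (\<forall>v. (\<forall>j. v j \<in> {0..2}) \<longrightarrow> e v < 3 ^ CARD('d)) \<and> e (\<lambda>_. 0) = 0"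
proof -
  let ?D = "{v :: 'd \<Rightarrow> int. \<forall>j. v j \<in> {0..2}}"
  have D: "?D = Pi\<^sub>E UNIV (\<lambda>_. {0..2})" by (auto simp: PiE_UNIV_domain)
  have fin: "finite ?D" unfolding D by (intro finite_PiE) auto
  have card: "card ?D = 3 ^ CARD('d)" unfolding D by (subst card_PiE) auto
  have z: "(\<lambda>_. 0) \<in> ?D" by auto
  have "card (?D - {\<lambda>_. 0}) = card {1..<3 ^ CARD('d) :: nat}"
    using fin z card by (subst card_Diff_singleton) auto
  then obtain g where g: "bij_betw g (?D - {\<lambda>_. 0}) {1..<3 ^ CARD('d) :: nat}"
    using finite_same_card_bij[of "?D - {\<lambda>_. 0}" "{1..<3 ^ CARD('d) :: nat}"] fin by auto
  define e where "e v = (if v = (\<lambda>_. 0) then 0 else g v)" for v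
  have gim: "g v \<in> {1..<3 ^ CARD('d)}" if "v \<in> ?D" "v \<noteq> (\<lambda>_. 0)" for v
    using bij_betwE[OF g] that by auto
  have "inj_on e ?D"
  proof (rule inj_onI)
    fix u v assume uv: "u \<in> ?D" "v \<in> ?D" "e u = e v"
    show "u = v"
      using gim[OF uv(1)] gim[OF uv(2)] uv bij_betw_imp_inj_on[OF g]
      by (auto simp: e_def inj_on_def split: if_splits)
  qed
  moreover have "e v < 3 ^ CARD('d)" if "v \<in> ?D" for v
    using gim[OF that] by (auto simp: e_def)
  moreover have "e (\<lambda>_. 0) = 0" by (simp add: e_def)
  ultimately show ?thesis by blast
qed

definition digit_code :: "('d::finite \<Rightarrow> int) \<Rightarrow> nat" where
  "digit_code = (SOME e. inj_on e {v. \<forall>j. v j \<in> {0..2}} \<and>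
     (\<forall>v. (\<forall>j. v j \<in> {0..2}) \<longrightarrow> e v < 3 ^ CARD('d)) \<and> e (\<lambda>_. 0) = 0)"

lemma digit_code:
  shows inj_digit_code: "inj_on digit_code {v :: 'd::finite \<Rightarrow> int. \<forall>j. v j \<in> {0..2}}"
    and digit_code_less: "(\<And>j. v j \<in> {0..2}) \<Longrightarrow> digit_code (v :: 'd \<Rightarrow> int) < 3 ^ CARD('d)"
    and digit_code_0: "digit_code (\<lambda>_ :: 'd. 0) = 0"
  using someI_ex[OF ex_digit_code[where 'd = 'd]] unfolding digit_code_def[symmetric] by blast+

text \<open>
  Rounding to the nearest multiple of 3, in units of 3: deletion of the last balanced ternary digit
  of each coordinate.  Rounding to the nearest multiple, rather than down, makes the iterated
  preimages of the origin cubes centred at the origin.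
\<close>

definition coarsen :: "('d \<Rightarrow> int) \<Rightarrow> 'd \<Rightarrow> int" where
  "coarsen z = (\<lambda>j. (z j + 1) div 3)"

lemma abs_coarsen_le:
  fixes x :: int
  shows "\<bar>(x + 1) div 3\<bar> \<le> \<bar>x\<bar>" and "x \<noteq> 0 \<Longrightarrow> \<bar>(x + 1) div 3\<bar> < \<bar>x\<bar>"
  by presburger+

lemma coarsen_decreases:
  fixes z :: "'d::finite \<Rightarrow> int"
  assumes "z \<noteq> (\<lambda>_. 0)"
  shows "(\<Sum>j\<in>UNIV. nat \<bar>coarsen z j\<bar>) < (\<Sum>j\<in>UNIV. nat \<bar>z j\<bar>)"
proof (rule sum_strict_mono_ex1)
  show "\<forall>j\<in>UNIV. nat \<bar>coarsen z j\<bar> \<le> nat \<bar>z j\<bar>"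
    unfolding coarsen_def by (intro ballI nat_mono abs_coarsen_le)
  from assms obtain j where "z j \<noteq> 0" by auto
  then have "nat \<bar>coarsen z j\<bar> < nat \<bar>z j\<bar>" unfolding coarsen_def using abs_coarsen_le(2)[of "z j"] by linarith
  then show "\<exists>j\<in>UNIV. nat \<bar>coarsen z j\<bar> < nat \<bar>z j\<bar>" by blast
qed simp

text \<open>
  Deleting balanced digits shrinks every nonzero integer, negative ones included, so the recursion
  ends at the origin.
\<close>

function morton :: "('d::finite \<Rightarrow> int) \<Rightarrow> nat" where
  "morton z = (if z = (\<lambda>_. 0) then 0
     else digit_code (\<lambda>j. z j mod 3) + 3 ^ CARD('d) * morton (coarsen z))"
  by auto
termination
  by (relation "Wellfounded.measure (\<lambda>z. \<Sum>j\<in>UNIV. nat \<bar>z j\<bar>)") (auto intro: coarsen_decreases)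

declare morton.simps [simp del]

lemma morton_0 [simp]: "morton (\<lambda>_. 0) = 0"
  by (simp add: morton.simps)

lemma morton_step:
  fixes z :: "'d::finite \<Rightarrow> int"
  shows "morton z = digit_code (\<lambda>j. z j mod 3) + 3 ^ CARD('d) * morton (coarsen z)"
proof (cases "z = (\<lambda>_. 0)")
  case True
  then show ?thesis by (simp add: digit_code_0 coarsen_def)
next
  case False
  then show ?thesis by (simp add: morton.simps[of z])
qed

lemma mod3_digit: "z j mod 3 \<in> {0..2}" for z :: "'d \<Rightarrow> int" using pos_mod_bound[of 3 "z j"] pos_mod_sign[of 3 "z j"] by simp

lemma morton_div: "morton z div 3 ^ CARD('d) = morton (coarsen z)"
  and morton_mod: "morton z mod 3 ^ CARD('d) = digit_code (\<lambda>j. z j mod 3)"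
  for z :: "'d::finite \<Rightarrow> int"
proof -
  have "digit_code (\<lambda>j. z j mod 3) < 3 ^ CARD('d)"
    by (rule digit_code_less) (rule mod3_digit)
  then show "morton z div 3 ^ CARD('d) = morton (coarsen z)"
    and "morton z mod 3 ^ CARD('d) = digit_code (\<lambda>j. z j mod 3)"
    by (subst morton_step; simp)+
qed

lemma morton_div_power:
  fixes z :: "'d::finite \<Rightarrow> int"
  shows "morton z div (3 ^ CARD('d)) ^ l = morton ((coarsen ^^ l) z)"
proof (induction l)
  case (Suc l)
  then show ?case by (simp add: div_mult2_eq power_Suc2 morton_div del: power_Suc)
qed simp

lemma int_eq_of_digit_and_coarsening:
  fixes a b :: int
  assumes "a mod 3 = b mod 3" "(a + 1) div 3 = (b + 1) div 3"
  shows "a = b"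
proof -
  obtain t where t: "a = b + 3 * t"
    using assms(1) by (metis mod_eqE)
  then have "a + 1 = (b + 1) + 3 * t" by simp
  then have "(a + 1) div 3 = (b + 1) div 3 + t" by simp
  then show "a = b" using assms(2) t by simp
qed

lemma inj_digits:
  fixes z z' :: "'d::finite \<Rightarrow> int"
  assumes "digit_code (\<lambda>j. z j mod 3) = digit_code (\<lambda>j. z' j mod 3)" "coarsen z = coarsen z'"
  shows "z = z'"
proof
  fix j
  have "(\<lambda>j. z j mod 3) = (\<lambda>j. z' j mod 3)"
    by (rule inj_onD[OF inj_digit_code]) (simp_all only: assms(1) mem_Collect_eq mod3_digit simp_thms)
  then have "z j mod 3 = z' j mod 3" by meson
  moreover have "(z j + 1) div 3 = (z' j + 1) div 3"
    using assms(2) unfolding coarsen_def by meson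
  ultimately show "z j = z' j" by (rule int_eq_of_digit_and_coarsening)
qed

lemma morton_eq_0_iff: "morton z = 0 \<longleftrightarrow> z = (\<lambda>_. 0)" for z :: "'d::finite \<Rightarrow> int"
proof
  show "morton z = 0 \<Longrightarrow> z = (\<lambda>_. 0)"
  proof (induction z rule: morton.induct)
    case (1 z)
    show ?case
    proof (rule ccontr)
      assume "z \<noteq> (\<lambda>_. 0)"
      moreover have "digit_code (\<lambda>j. z j mod 3) = 0" "morton (coarsen z) = 0"
        using \<open>morton z = 0\<close> morton_step[of z] by auto
      ultimately show False
        using 1(1) inj_digits[of z "\<lambda>_. 0"] by (auto simp: digit_code_0 coarsen_def)
    qed
  qed
qed simp

lemma inj_morton: "inj (morton :: ('d::finite \<Rightarrow> int) \<Rightarrow> nat)"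
proof (rule injI)
  fix z z' :: "'d \<Rightarrow> int"
  show "morton z = morton z' \<Longrightarrow> z = z'"
  proof (induction z arbitrary: z' rule: morton.induct)
    case (1 z)
    show ?case
    proof (cases "z = (\<lambda>_. 0)")
      case True then show ?thesis using 1(2) morton_eq_0_iff[of z'] by auto
    next
      case False
      have "coarsen z = coarsen z'" using 1(1)[OF False] 1(2) morton_div by metis
      moreover have "digit_code (\<lambda>j. z j mod 3) = digit_code (\<lambda>j. z' j mod 3)" using 1(2) morton_mod by metis
      ultimately show ?thesis using inj_digits by blast
    qed
  qed
qed

lemma coarsen_step_bounds:
  fixes a b :: int
  shows "\<bar>a - b\<bar> \<le> 3 * \<bar>(a + 1) div 3 - (b + 1) div 3\<bar> + 2"
    and "3 * (2 * \<bar>(a + 1) div 3\<bar> - 1) \<le> 2 * \<bar>a\<bar> - 1"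
proof -
  define u v where "u = (a + 1) div 3" and "v = (b + 1) div 3"
  have "3 * u \<le> a + 1" "a + 1 \<le> 3 * u + 2" "3 * v \<le> b + 1" "b + 1 \<le> 3 * v + 2"
    unfolding u_def v_def by presburger+
  note bounds = this
  show "\<bar>a - b\<bar> \<le> 3 * \<bar>(a + 1) div 3 - (b + 1) div 3\<bar> + 2"
    unfolding u_def[symmetric] v_def[symmetric] using bounds by (smt (verit))
  show "3 * (2 * \<bar>(a + 1) div 3\<bar> - 1) \<le> 2 * \<bar>a\<bar> - 1"
    unfolding u_def[symmetric] using bounds by (auto simp: abs_if)
qed

text \<open>
  Lattice points that agree after \<open>l\<close> deletions lie in a common cell, which has \<open>3\<^sup>l\<close> points along
  each axis.
\<close>

lemma coarsen_power_dist:
  "\<bar>z j - z' j\<bar> \<le> 3 ^ l * \<bar>(coarsen ^^ l) z j - (coarsen ^^ l) z' j\<bar> + (3 ^ l - 1)"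
proof (induction l)
  case (Suc l)
  let ?a = "(coarsen ^^ l) z j" and ?b = "(coarsen ^^ l) z' j"
  have "\<bar>?a - ?b\<bar> \<le> 3 * \<bar>coarsen ((coarsen ^^ l) z) j - coarsen ((coarsen ^^ l) z') j\<bar> + 2"
    unfolding coarsen_def by (rule coarsen_step_bounds)
  then have "3 ^ l * \<bar>?a - ?b\<bar> \<le> 3 ^ l * (3 * \<bar>coarsen ((coarsen ^^ l) z) j - coarsen ((coarsen ^^ l) z') j\<bar> + 2)"
    by (intro mult_left_mono) auto
  with Suc show ?case by (simp add: algebra_simps)
qed simp

text \<open>
  In particular, a point whose coarsening is still nonzero lies outside the centred cube of
  half-width \<open>(3\<^sup>l - 1) / 2\<close>.
\<close>

lemma coarsen_power_size:
  "2 * \<bar>z j\<bar> \<ge> 3 ^ l * (2 * \<bar>(coarsen ^^ l) z j\<bar> - 1) + 1"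
proof (induction l)
  case (Suc l)
  let ?a = "(coarsen ^^ l) z j"
  have "3 * (2 * \<bar>coarsen ((coarsen ^^ l) z) j\<bar> - 1) \<le> 2 * \<bar>?a\<bar> - 1"
    unfolding coarsen_def by (rule coarsen_step_bounds)
  then have "3 ^ l * (3 * (2 * \<bar>coarsen ((coarsen ^^ l) z) j\<bar> - 1)) \<le> 3 ^ l * (2 * \<bar>?a\<bar> - 1)"
    by (intro mult_left_mono) auto
  with Suc show ?case by (simp add: algebra_simps)
qed simp

lemma infnorm_vec_le: "(\<And>i. \<bar>x $ i\<bar> \<le> c) \<Longrightarrow> infnorm (x :: real ^ 'd) \<le> c"
  unfolding infnorm_cart by (rule cSup_least) auto

text \<open>
  The two ways in which the order remembers the geometry: equal leading digits force points to be
  close at the corresponding scale, and a key with many digits forces a point to be far out.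
  The constants absorb the error \<open>3\<^sup>-\<^sup>n / 2\<close> made by rounding each coordinate to the lattice.
\<close>

lemma ex_key:
  obtains \<kappa> :: "real ^ 'd \<Rightarrow> nat" where "\<kappa> \<in> borel \<rightarrow>\<^sub>M count_space UNIV"
    "\<And>x y l. \<kappa> x div (3 ^ CARD('d)) ^ l = \<kappa> y div (3 ^ CARD('d)) ^ l \<Longrightarrow> infnorm (x - y) \<le> 3 ^ l / 3 ^ n"
    "\<And>x l. (3 ^ CARD('d)) ^ l \<le> \<kappa> x \<Longrightarrow> 3 ^ l / 3 ^ n / 2 \<le> infnorm x"
proof
  define Z where "Z x j = round (3 ^ n * x $ j)" for x :: "real ^ 'd" and j
  let ?\<kappa> = "\<lambda>x. morton (Z x)"
  have Zr: "\<bar>of_int (Z x j) - 3 ^ n * x $ j\<bar> \<le> 1 / 2" for x j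
    unfolding Z_def by (rule of_int_round_abs_le)
  show "?\<kappa> \<in> borel \<rightarrow>\<^sub>M count_space UNIV"
  proof (subst measurable_count_space_eq2_countable, safe)
    fix i
    show "?\<kappa> -` {i} \<inter> space borel \<in> sets borel"
    proof (cases "i \<in> range (morton :: ('d \<Rightarrow> int) \<Rightarrow> nat)")
      case True
      then obtain z :: "'d \<Rightarrow> int" where z: "i = morton z" by auto
      have "?\<kappa> -` {i} \<inter> space borel = {x \<in> space borel. \<forall>j. Z x j = z j}"
        using z by (auto simp: inj_eq[OF inj_morton] fun_eq_iff)
      also have "\<dots> \<in> sets borel"
        unfolding Z_def round_def by measurable
      finally show ?thesis .
    next
      case False
      then have "?\<kappa> -` {i} = {}" by auto
      then show ?thesis by simp
    qed
  qed auto
  fix l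
  show "infnorm (x - y) \<le> 3 ^ l / 3 ^ n" if "?\<kappa> x div (3 ^ CARD('d)) ^ l = ?\<kappa> y div (3 ^ CARD('d)) ^ l" for x y
  proof (rule infnorm_vec_le)
    fix j
    have "(coarsen ^^ l) (Z x) = (coarsen ^^ l) (Z y)"
      using that unfolding morton_div_power by (rule injD[OF inj_morton])
    then have "\<bar>Z x j - Z y j\<bar> \<le> 3 ^ l - 1" using coarsen_power_dist[of "Z x" j "Z y" l] by simp
    then have "\<bar>of_int (Z x j) - of_int (Z y j)\<bar> \<le> (3 ^ l - 1 :: real)"
      by (metis (mono_tags, lifting) of_int_1 of_int_abs of_int_diff of_int_le_iff of_int_numeral of_int_power)
    then have "\<bar>3 ^ n * x $ j - 3 ^ n * y $ j\<bar> \<le> 3 ^ l"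
      using Zr[of x j] Zr[of y j] by linarith
    then have "\<bar>3 ^ n * (x $ j - y $ j)\<bar> \<le> 3 ^ l" by (simp only: right_diff_distrib)
    then show "\<bar>(x - y) $ j\<bar> \<le> 3 ^ l / 3 ^ n"
      by (simp add: abs_mult pos_le_divide_eq mult.commute)
  qed
  show "3 ^ l / 3 ^ n / 2 \<le> infnorm x" if "(3 ^ CARD('d)) ^ l \<le> ?\<kappa> x" for x
  proof -
    have "?\<kappa> x div (3 ^ CARD('d)) ^ l \<noteq> 0" using that by (simp add: div_eq_0_iff)
    then obtain j where j: "(coarsen ^^ l) (Z x) j \<noteq> 0"
      unfolding morton_div_power morton_eq_0_iff by auto
    then have "1 \<le> 2 * \<bar>(coarsen ^^ l) (Z x) j\<bar> - 1" by linarith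
    then have "3 ^ l * 1 \<le> 3 ^ l * (2 * \<bar>(coarsen ^^ l) (Z x) j\<bar> - 1)" by (intro mult_left_mono) auto
    with coarsen_power_size[of l "Z x" j] have "3 ^ l + 1 \<le> 2 * \<bar>Z x j\<bar>" by linarith
    then have "3 ^ l + 1 \<le> 2 * \<bar>of_int (Z x j) :: real\<bar>"
      by (metis (mono_tags, lifting) of_int_1 of_int_abs of_int_add of_int_le_iff of_int_mult of_int_numeral of_int_power)
    with Zr[of x j] have "3 ^ l \<le> 2 * \<bar>3 ^ n * x $ j\<bar>" by linarith
    then have "3 ^ l / 3 ^ n / 2 \<le> \<bar>x $ j\<bar>" by (simp add: field_simps abs_mult)
    also have "\<dots> \<le> infnorm x" by (rule component_le_infnorm_cart)
    finally show ?thesis .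
  qed
qed

section \<open>The transport cost of the cutting\<close>

text \<open>
  The open intervals \<open>((k - 1)/n, k/n)\<close> are disjoint, so each boundary \<open>F (m c)\<close> is straddled by at
  most one piece.
\<close>

lemma straddled_pieces_card:
  fixes F :: "nat \<Rightarrow> real" and n M c :: nat
  assumes n: "n > 0"
  shows "card {k \<in> {1..n}. \<exists>m. 0 < m \<and> m < M \<and> real (k - 1) / n < F (m * c) \<and> F (m * c) < real k / n} \<le> M"
    (is "card ?E \<le> M")
proof -
  have "\<forall>k\<in>?E. \<exists>m. 0 < m \<and> m < M \<and> real (k - 1) / n < F (m * c) \<and> F (m * c) < real k / n" by blast
  from bchoice[OF this] obtain f where
    f: "\<And>k. k \<in> ?E \<Longrightarrow> f k < M \<and> real (k - 1) / n < F (f k * c) \<and> F (f k * c) < real k / n" by blast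
  have "inj_on f ?E"
  proof (rule inj_onI)
    fix k k' assume kk: "k \<in> ?E" "k' \<in> ?E" "f k = f k'"
    have "real (k - 1) / n < real k' / n" "real (k' - 1) / n < real k / n"
      using f[OF kk(1)] f[OF kk(2)] kk(3) by auto
    then have "k - 1 < k'" "k' - 1 < k" using n by (simp_all add: divide_less_cancel)
    then show "k = k'" using kk(1,2) by auto
  qed
  moreover have "f ` ?E \<subseteq> {..<M}" using f by auto
  ultimately have "card ?E \<le> card {..<M}" by (intro card_inj_on_le) auto
  then show ?thesis by simp
qed

text \<open>
  The points do not depend on \<open>p\<close> and on the cut-off radius \<open>3\<^sup>J\<close>, so the radius can be optimised
  for each \<open>p\<close> afterwards.  The resolution \<open>3\<^sup>-\<^sup>n\<close> of the key is far finer than \<open>n\<^sup>-\<^sup>1\<^sup>/\<^sup>d\<close>, which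
  makes the rounding error one more term of the multiscale sum.
\<close>

lemma quantization_cost_bound:
  fixes \<rho> :: "(real ^ 'd) measure" and q :: real
  assumes \<rho>: "prob_space \<rho>" "sets \<rho> = sets borel"
    and int: "integrable \<rho> (\<lambda>x. infnorm x powr q)"
    and n: "n > 0"
  defines "\<tau> \<equiv> \<lambda>J::nat. \<integral>x. indicator {x. 3 ^ J / 2 \<le> infnorm x} x * infnorm x powr q \<partial>\<rho>"
  shows "\<exists>y :: nat \<Rightarrow> real ^ 'd. \<forall>p J. 1 \<le> p \<and> p < q \<longrightarrow>
    transport_cost p (empirical_measure n y) \<rho> \<le> ennreal (
      3 ^ CARD('d) * (3 ^ J) powr p * (\<Sum>s\<le>n + J. (1 / 3 ^ s) powr p * min 1 (3 ^ (CARD('d) * s) / real n))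
      + 6 powr p * (3 ^ J / 2) powr (p - q) * \<tau> J)"
proof -
  interpret prob_space \<rho> by fact
  note [measurable_cong] = \<rho>(2)
  have space: "space \<rho> = UNIV" using sets_eq_imp_space_eq[OF \<rho>(2)] by simp
  define B :: nat where "B = 3 ^ CARD('d)"
  have B: "B \<ge> 3" unfolding B_def using self_le_power[of "3::nat" "CARD('d)"] by simp
  obtain \<kappa> :: "real ^ 'd \<Rightarrow> nat" where \<kappa>[measurable]: "\<kappa> \<in> borel \<rightarrow>\<^sub>M count_space UNIV"
    and close: "\<And>x y l. \<kappa> x div B ^ l = \<kappa> y div B ^ l \<Longrightarrow> infnorm (x - y) \<le> 3 ^ l / 3 ^ n"
    and far: "\<And>x l. B ^ l \<le> \<kappa> x \<Longrightarrow> 3 ^ l / 3 ^ n / 2 \<le> infnorm x"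
    using ex_key[where 'd = 'd and n = n] unfolding B_def by blast
  define F where "F i = measure \<rho> {x \<in> space \<rho>. \<kappa> x < i}" for i
  obtain w :: "nat \<Rightarrow> nat \<Rightarrow> real" and first :: "nat \<Rightarrow> nat"
  where w0: "\<And>k i. 0 \<le> w k i" and wsum: "\<And>i. (\<Sum>k=1..n. w k i) = 1"
    and wint: "\<And>k. k \<in> {1..n} \<Longrightarrow> (\<integral>\<^sup>+ x. w k (\<kappa> x) \<partial>\<rho>) = ennreal (1 / n)"
    and ex: "\<And>k. k \<in> {1..n} \<Longrightarrow> \<exists>x \<in> space \<rho>. \<kappa> x = first k"
    and AE: "AE x in \<rho>. \<forall>k\<in>{1..n}. w k (\<kappa> x) > 0 \<longrightarrow> first k \<le> \<kappa> x \<and>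
       (\<forall>b. first k < b \<and> b \<le> \<kappa> x \<longrightarrow> real (k - 1) / n < F b \<and> F b < real k / n)"
  proof -
    have "\<kappa> \<in> \<rho> \<rightarrow>\<^sub>M count_space UNIV" by measurable
    from chop_law[OF this n, folded F_def] that show thesis by blast
  qed
  from ex obtain y where y: "\<And>k. k \<in> {1..n} \<Longrightarrow> \<kappa> (y k) = first k" by metis
  show ?thesis
  proof (intro exI[of _ y] allI impI, elim conjE)
    fix p :: real and J :: nat assume p: "1 \<le> p" "p < q"
    define N where "N = n + J"
    define t :: "nat \<Rightarrow> real" where "t l = (3 ^ l / 3 ^ n) powr p" for l
    \<comment> \<open>the pieces that may need a cell of level \<open>l\<close>, i.e. those that straddle a boundary of level
      \<open>l - 1\<close> inside the centred cube of level \<open>N\<close>\<close>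
    define E where "E l = {k \<in> {1..n}. l = 0 \<or> (\<exists>m. 0 < m \<and> m < B ^ Suc (N - l) \<and>
        real (k - 1) / n < F (m * B ^ (l - 1)) \<and> F (m * B ^ (l - 1)) < real k / n)}" for l
    define H :: "real ^ 'd \<Rightarrow> real" where
      "H x = 6 powr p * (3 ^ J / 2) powr (p - q) * (indicator {x. 3 ^ J / 2 \<le> infnorm x} x * infnorm x powr q)" for x
    define D where "D k = (\<Sum>l\<le>N. t l * indicator (E l) k)" for k
    have t0: "t l \<ge> 0" for l by (simp add: t_def)
    have D0: "D k \<ge> 0" for k unfolding D_def by (intro sum_nonneg) (auto simp: t0)
    have H0: "H x \<ge> 0" for x by (simp add: H_def)
    have H[measurable]: "H \<in> borel_measurable borel" unfolding H_def by measurable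

    have main: "infnorm (y k - x) powr p \<le> D k + H x"
      if k: "k \<in> {1..n}" and le: "first k \<le> \<kappa> x"
        and str: "\<And>b. first k < b \<Longrightarrow> b \<le> \<kappa> x \<Longrightarrow> real (k - 1) / n < F b \<and> F b < real k / n" for k x
    proof (cases "\<kappa> x < B ^ N")
      case True
      \<comment> \<open>the piece and the point it moves to share a centred cube of level \<open>N\<close>; charge the move to the
        smallest common cell, which has level \<open>l\<close>\<close>
      let ?P = "\<lambda>l. first k div B ^ l = \<kappa> x div B ^ l"
      define l where "l = (LEAST l. ?P l)"
      have PN: "?P N" using True le by simp
      then have Pl: "?P l" unfolding l_def by (rule LeastI)
      have lN: "l \<le> N" unfolding l_def using PN by (rule Least_le)
      have "infnorm (y k - x) \<le> 3 ^ l / 3 ^ n" using Pl y[OF k] by (intro close) simp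
      then have "infnorm (y k - x) powr p \<le> t l"
        unfolding t_def using p by (intro powr_mono2) (auto simp: infnorm_pos_le)
      moreover have "k \<in> E l"
      proof (cases l)
        case 0 then show ?thesis using k by (simp add: E_def)
      next
        case (Suc i)
        then have "\<not> ?P i" using not_less_Least[of i ?P] unfolding l_def[symmetric] by simp
        then have lt: "first k div B ^ i < \<kappa> x div B ^ i" using div_le_mono[OF le, of "B ^ i"] by simp
        define m where "m = \<kappa> x div B ^ i"
        have "m * B ^ i \<le> \<kappa> x" by (simp add: m_def)
        moreover have "first k < m * B ^ i"
          using lt B by (simp add: m_def div_less_iff_less_mult)
        moreover have "N = i + Suc (N - l)" using lN Suc by simp
        then have "B ^ N = B ^ Suc (N - l) * B ^ i" by (metis power_add mult.commute)
        then have "m < B ^ Suc (N - l)"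
          using True B by (simp add: m_def div_less_iff_less_mult del: power_Suc)
        ultimately show ?thesis
          using k str[of "m * B ^ i"] lt Suc by (auto simp: E_def m_def intro!: exI[of _ m])
      qed
      ultimately have "infnorm (y k - x) powr p \<le> t l * indicator (E l) k" by simp
      also have "\<dots> \<le> D k"
        unfolding D_def using lN by (intro member_le_sum) (auto simp: t0)
      finally show ?thesis using H0[of x] by linarith
    next
      case False
      \<comment> \<open>outside the cut-off cube: use the smallest centred cube that contains \<open>x\<close>; since \<open>y k\<close> comes
        no later in the order, it lies in that cube too\<close>
      have "\<kappa> x < B ^ \<kappa> x" using B by (intro power_gt_expt) simp
      define L where "L = (LEAST L. \<kappa> x < B ^ L)"
      have L: "\<kappa> x < B ^ L" unfolding L_def by (rule LeastI) fact
      have "N < L"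
      proof (rule ccontr)
        assume "\<not> N < L"
        then have "B ^ L \<le> B ^ N" using B by (intro power_increasing) auto
        with L False show False by linarith
      qed
      then obtain i where i: "L = Suc i" "N \<le> i" by (cases L) auto
      have "\<not> \<kappa> x < B ^ i" using not_less_Least[of i "\<lambda>L. \<kappa> x < B ^ L"] i unfolding L_def[symmetric] by simp
      then have f: "3 ^ i / 3 ^ n / 2 \<le> infnorm x" by (intro far) simp
      have "infnorm (y k - x) \<le> 3 ^ L / 3 ^ n" using L le y[OF k] by (intro close) simp
      also have "\<dots> = 6 * (3 ^ i / 3 ^ n / 2)" by (simp add: i)
      also have "\<dots> \<le> 6 * infnorm x" using f by simp
      finally have d: "infnorm (y k - x) \<le> 6 * infnorm x" .
      have "(3::real) ^ N \<le> 3 ^ i" using i by (intro power_increasing) auto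
      then have "(3::real) ^ J \<le> 3 ^ i / 3 ^ n" by (simp add: N_def power_add field_simps)
      from divide_right_mono[OF this, of 2] f have R: "3 ^ J / 2 \<le> infnorm x" by simp
      have R0: "(0::real) < 3 ^ J / 2" by simp
      have "infnorm (y k - x) powr p \<le> (6 * infnorm x) powr p"
        using d p by (intro powr_mono2) (auto simp: infnorm_pos_le)
      also have "\<dots> = 6 powr p * (infnorm x powr (p - q) * infnorm x powr q)"
        using R R0 by (simp add: powr_mult infnorm_pos_le flip: powr_add)
      also have "\<dots> \<le> 6 powr p * ((3 ^ J / 2) powr (p - q) * infnorm x powr q)"
        using R R0 p by (intro mult_left_mono mult_right_mono powr_mono2') auto
      also have "\<dots> = H x" using R by (simp add: H_def)
      finally show ?thesis using D0[of k] by linarith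
    qed

    have "transport_cost p (empirical_measure n y) \<rho>
        \<le> (\<Sum>k=1..n. \<integral>\<^sup>+ x. ennreal (w k (\<kappa> x)) * ennreal (infnorm (y k - x) powr p) \<partial>\<rho>)"
    proof (rule transport_cost_le_weights[OF \<rho> n])
      show "(\<lambda>x. ennreal (w k (\<kappa> x))) \<in> borel_measurable borel" for k by measurable
      show "(\<Sum>k=1..n. ennreal (w k (\<kappa> x))) = 1" for x
        using w0 wsum[of "\<kappa> x"] by (simp add: sum_ennreal)
      show "(\<integral>\<^sup>+ x. ennreal (w k (\<kappa> x)) \<partial>\<rho>) = 1 / of_nat n" if "k \<in> {1..n}" for k
        using wint[OF that] n by (simp add: divide_ennreal[symmetric] ennreal_of_nat_eq_real_of_nat)
    qed
    also have "\<dots> \<le> (\<Sum>k=1..n. \<integral>\<^sup>+ x. ennreal (w k (\<kappa> x)) * ennreal (D k) + ennreal (w k (\<kappa> x)) * ennreal (H x) \<partial>\<rho>)"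
    proof (intro sum_mono nn_integral_mono_AE)
      fix k assume k: "k \<in> {1..n}"
      show "AE x in \<rho>. ennreal (w k (\<kappa> x)) * ennreal (infnorm (y k - x) powr p)
          \<le> ennreal (w k (\<kappa> x)) * ennreal (D k) + ennreal (w k (\<kappa> x)) * ennreal (H x)"
        using AE
      proof eventually_elim
        case (elim x)
        show ?case
        proof (cases "w k (\<kappa> x) > 0")
          case True
          then have "infnorm (y k - x) powr p \<le> D k + H x" using elim k by (intro main) auto
          then have "ennreal (infnorm (y k - x) powr p) \<le> ennreal (D k) + ennreal (H x)"
            using D0 H0 by (simp flip: ennreal_plus)
          then show ?thesis unfolding distrib_left[symmetric] by (intro mult_left_mono) auto
        next
          case False then show ?thesis using w0[of k "\<kappa> x"] by (simp add: ennreal_neg)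
        qed
      qed
    qed
    also have "\<dots> = (\<Sum>k=1..n. (\<integral>\<^sup>+ x. ennreal (w k (\<kappa> x)) \<partial>\<rho>) * ennreal (D k))
        + (\<Sum>k=1..n. \<integral>\<^sup>+ x. ennreal (w k (\<kappa> x)) * ennreal (H x) \<partial>\<rho>)"
      by (subst nn_integral_add) (auto simp: sum.distrib nn_integral_multc)
    also have "(\<Sum>k=1..n. (\<integral>\<^sup>+ x. ennreal (w k (\<kappa> x)) \<partial>\<rho>) * ennreal (D k))
        = (\<Sum>k=1..n. ennreal (1 / n * D k))"
      using D0 by (intro sum.cong refl) (simp add: wint flip: ennreal_mult)
    also have "\<dots> = ennreal (\<Sum>k=1..n. 1 / n * D k)"
      using D0 by (intro sum_ennreal) auto
    also have "(\<Sum>k=1..n. \<integral>\<^sup>+ x. ennreal (w k (\<kappa> x)) * ennreal (H x) \<partial>\<rho>)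
        = (\<integral>\<^sup>+ x. (\<Sum>k=1..n. ennreal (w k (\<kappa> x))) * ennreal (H x) \<partial>\<rho>)"
      by (subst nn_integral_sum[symmetric]) (auto simp: sum_distrib_right)
    also have "\<dots> = (\<integral>\<^sup>+ x. ennreal (H x) \<partial>\<rho>)"
      using w0 wsum by (simp add: sum_ennreal)
    also have "\<dots> = ennreal (\<integral>x. H x \<partial>\<rho>)"
    proof (rule nn_integral_eq_integral)
      have "integrable \<rho> (\<lambda>x. indicator {x. 3 ^ J / 2 \<le> infnorm x} x * infnorm x powr q)"
        by (rule Bochner_Integration.integrable_bound[OF int]) (auto simp: indicator_def)
      then show "integrable \<rho> H" unfolding H_def by (rule integrable_mult_right)
    qed (simp add: H0)
    also have "(\<integral>x. H x \<partial>\<rho>) = 6 powr p * (3 ^ J / 2) powr (p - q) * \<tau> J"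
      unfolding H_def \<tau>_def by (rule integral_mult_right_zero)
    also have "(\<Sum>k=1..n. 1 / n * D k) = (\<Sum>l\<le>N. t l * (real (card (E l)) / n))"
    proof -
      have "(\<Sum>k=1..n. indicator (E l) k :: real) = card (E l)" for l
      proof -
        have "{1..n} \<inter> E l = E l" by (auto simp: E_def)
        then show ?thesis by (simp add: indicator_def of_bool_def sum.If_cases)
      qed
      then show ?thesis
        unfolding D_def sum_distrib_left
        by (subst sum.swap) (simp add: sum_distrib_left[symmetric] sum_divide_distrib[symmetric])
    qed
    also have "ennreal (\<Sum>l\<le>N. t l * (real (card (E l)) / n)) + ennreal (6 powr p * (3 ^ J / 2) powr (p - q) * \<tau> J)
      = ennreal ((\<Sum>l\<le>N. t l * (real (card (E l)) / n)) + 6 powr p * (3 ^ J / 2) powr (p - q) * \<tau> J)"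
      unfolding \<tau>_def by (intro ennreal_plus[symmetric] sum_nonneg mult_nonneg_nonneg integral_nonneg) (auto simp: t0)
    also have "\<dots> \<le> ennreal (B * (3 ^ J) powr p * (\<Sum>s\<le>N. (1 / 3 ^ s) powr p * min 1 (3 ^ (CARD('d) * s) / real n))
        + 6 powr p * (3 ^ J / 2) powr (p - q) * \<tau> J)"
    proof (intro ennreal_leI add_right_mono)
      have cardE: "real (card (E l)) / n \<le> B * min 1 (3 ^ (CARD('d) * (N - l)) / real n)" if "l \<le> N" for l
      proof -
        have "card (E l) \<le> card {1..n}" by (intro card_mono) (auto simp: E_def)
        then have c1: "real (card (E l)) / n \<le> 1" using n by simp
        have c2: "real (card (E l)) / n \<le> B * (3 ^ (CARD('d) * (N - l)) / real n)"
        proof (cases "l = 0")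
          case True
          \<comment> \<open>at the finest level the minimum is 1, because \<open>n \<le> 3\<^sup>n\<close>\<close>
          have "n < 3 ^ n" by (rule power_gt_expt) simp
          also have "(3::nat) ^ n \<le> 3 ^ (CARD('d) * N)"
          proof (rule power_increasing)
            have "1 * N \<le> CARD('d) * N" by (intro mult_right_mono) (auto simp: Suc_le_eq)
            then show "n \<le> CARD('d) * N" using N_def by linarith
          qed simp
          finally have "real n \<le> real (3 ^ (CARD('d) * N))" by (simp only: of_nat_le_iff)
          then have "1 \<le> 3 ^ (CARD('d) * N) / real n" using n by simp
          also have "\<dots> \<le> B * (3 ^ (CARD('d) * N) / real n)"
            using B mult_right_mono[of 1 "real B" "3 ^ (CARD('d) * N) / real n"] by simp
          finally show ?thesis using c1 True by simp
        next
          case False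
          then have "card (E l) \<le> B ^ Suc (N - l)"
            using straddled_pieces_card[OF n, of "B ^ Suc (N - l)" F "B ^ (l - 1)"] by (simp add: E_def)
          then have "real (card (E l)) \<le> real (B ^ Suc (N - l))" by (simp only: of_nat_le_iff)
          also have "\<dots> = B * 3 ^ (CARD('d) * (N - l))" by (simp add: B_def power_mult)
          finally show ?thesis using n by (simp add: divide_right_mono)
        qed
        show ?thesis using c1 c2 B by (auto simp: min_def)
      qed
      have "(\<Sum>l\<le>N. t l * (real (card (E l)) / n))
          \<le> (\<Sum>l\<le>N. t l * (B * min 1 (3 ^ (CARD('d) * (N - l)) / real n)))"
        using t0 cardE by (intro sum_mono mult_left_mono) auto
      also have "\<dots> = (\<Sum>s\<le>N. t (N - s) * (B * min 1 (3 ^ (CARD('d) * s) / real n)))"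
        by (rule sum.reindex_bij_witness[of _ "\<lambda>s. N - s" "\<lambda>s. N - s"]) auto
      also have "\<dots> = (\<Sum>s\<le>N. B * (3 ^ J) powr p * ((1 / 3 ^ s) powr p * min 1 (3 ^ (CARD('d) * s) / real n)))"
      proof (intro sum.cong refl)
        fix s assume "s \<in> {..N}"
        then have "(3::real) ^ (N - s) * 3 ^ s = 3 ^ J * 3 ^ n"
          by (simp add: N_def flip: power_add)
        then have "(3::real) ^ (N - s) / 3 ^ n = 3 ^ J * (1 / 3 ^ s)" by (simp add: field_simps)
        then have "t (N - s) = (3 ^ J) powr p * (1 / 3 ^ s) powr p"
          unfolding t_def by (simp only:) (rule powr_mult; simp)
        then show "t (N - s) * (B * min 1 (3 ^ (CARD('d) * s) / real n)) =
            B * (3 ^ J) powr p * ((1 / 3 ^ s) powr p * min 1 (3 ^ (CARD('d) * s) / real n))"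
          by simp
      qed
      finally show "(\<Sum>l\<le>N. t l * (real (card (E l)) / n))
        \<le> B * (3 ^ J) powr p * (\<Sum>s\<le>N. (1 / 3 ^ s) powr p * min 1 (3 ^ (CARD('d) * s) / real n))"
        by (simp only: sum_distrib_left)
    qed
    finally show "transport_cost p (empirical_measure n y) \<rho> \<le> ennreal (
      3 ^ CARD('d) * (3 ^ J) powr p * (\<Sum>s\<le>n + J. (1 / 3 ^ s) powr p * min 1 (3 ^ (CARD('d) * s) / real n))
      + 6 powr p * (3 ^ J / 2) powr (p - q) * \<tau> J)"
      by (simp add: B_def N_def)
  qed
qed

section \<open>The multiscale sum and the rate\<close>

lemma ex_power_interval:
  fixes b Y :: real
  assumes "b > 1" "Y \<ge> 1"
  obtains k where "b ^ k \<le> Y" "Y < b ^ Suc k"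
proof -
  obtain m where "Y < b ^ m" using real_arch_pow[OF \<open>b > 1\<close>] by blast
  then have L: "Y < b ^ (LEAST m. Y < b ^ m)" by (rule LeastI)
  with \<open>Y \<ge> 1\<close> obtain k where k: "(LEAST m. Y < b ^ m) = Suc k"
    by (cases "LEAST m. Y < b ^ m") auto
  then have "\<not> Y < b ^ k" using not_less_Least[of k "\<lambda>m. Y < b ^ m"] by simp
  then show thesis using that[of k] L k by simp
qed

text \<open>
  Turns powers indexed by the scale into powers of the number of cells at that scale, which is then
  compared with \<open>n\<close>.
\<close>

lemma power_powr_rescale:
  assumes "d \<ge> 1"
  shows "(3 powr a) ^ m = ((3 ^ d) ^ m) powr (a / real d)"
proof -
  have "((3::real) ^ d) ^ m = 3 powr real (d * m)"
    by (simp only: power_mult[symmetric] powr_realpow)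
  then have "((3 ^ d) ^ m) powr (a / real d) = 3 powr (real (d * m) * (a / real d))"
    by (simp only: powr_powr)
  also have "real (d * m) * (a / real d) = a * real m" using assms by simp
  finally show ?thesis by (simp add: powr_power mult.commute)
qed

lemma geometric_tail_le:
  fixes r :: real
  assumes "0 < r" "r < 1"
  shows "(\<Sum>s=m..<m + K. r ^ s) \<le> r ^ m / (1 - r)"
proof -
  have "(1 - r) * (\<Sum>s=m..<m + K. r ^ s) = r ^ m - r ^ (m + K)"
  proof (induction K)
    case (Suc K)
    have "(1 - r) * (\<Sum>s=m..<m + Suc K. r ^ s) = (1 - r) * (\<Sum>s=m..<m + K. r ^ s) + (1 - r) * r ^ (m + K)"
      by (simp add: distrib_left)
    also have "\<dots> = (r ^ m - r ^ (m + K)) + (1 - r) * r ^ (m + K)" by (simp only: Suc)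
    also have "\<dots> = r ^ m - r ^ (m + Suc K)" by (simp add: algebra_simps)
    finally show ?case .
  qed simp
  also have "\<dots> \<le> r ^ m" using assms by simp
  finally show ?thesis using assms by (simp add: pos_le_divide_eq mult.commute)
qed

text \<open>
  Split at the critical scale \<open>m\<close>, where the number of cells \<open>3\<^sup>d\<^sup>m\<close> reaches \<open>n\<close>.  Beyond it the sum is
  geometric with ratio \<open>3\<^sup>-\<^sup>p\<close> and has the size of its first term.
\<close>

lemma multiscale_sum_split:
  fixes p :: real and d n :: nat
  defines "r \<equiv> 3 powr (- p)"
  assumes p: "p \<ge> 1" and d: "d \<ge> 1" and n: "n \<ge> 1"
  obtains m where "(3 ^ d) ^ m \<le> real n"
    "\<And>N. (\<Sum>s\<le>N. (1 / 3 ^ s) powr p * min 1 (3 ^ (d * s) / real n))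
       \<le> (\<Sum>s\<le>m. (r * 3 ^ d) ^ s) / real n + real n powr (- p / d) / (1 - r)"
proof -
  have r: "0 < r" "r < 1" using p powr_less_mono[of "-p" 0 3] by (auto simp: r_def)
  have rs: "(1 / 3 ^ s) powr p = r ^ s" for s
    by (simp add: r_def powr_minus powr_divide powr_power powr_realpow[symmetric] powr_powr mult.commute divide_simps)
  have "(1::real) < 3 ^ d" using d by (simp add: one_less_power)
  then obtain m where m: "(3 ^ d) ^ m \<le> real n" "real n < (3 ^ d) ^ Suc m"
    using ex_power_interval[of "3 ^ d" "real n"] n by auto
  have tail: "r ^ Suc m \<le> real n powr (- p / d)"
  proof -
    have "r ^ Suc m = ((3 ^ d) ^ Suc m) powr (- p / d)"
      unfolding r_def using d by (rule power_powr_rescale)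
    also have "\<dots> \<le> real n powr (- p / d)"
      using m(2) n p d by (intro powr_mono2') (auto simp del: power_Suc simp: divide_nonpos_pos)
    finally show ?thesis .
  qed
  show thesis
  proof (rule that[OF m(1)])
    fix N
    let ?f = "\<lambda>s. (1 / 3 ^ s) powr p * min 1 (3 ^ (d * s) / real n)"
    have f0: "?f s \<ge> 0" for s by simp
    have f1: "?f s \<le> (r * 3 ^ d) ^ s / n" for s
    proof -
      have "?f s \<le> r ^ s * (3 ^ (d * s) / n)" unfolding rs using r by (intro mult_left_mono) auto
      then show ?thesis by (simp add: power_mult_distrib power_mult)
    qed
    have f2: "?f s \<le> r ^ s" for s
      unfolding rs using r mult_left_mono[of "min 1 (3 ^ (d * s) / real n)" 1 "r ^ s"] by simp
    have "(\<Sum>s\<le>N. ?f s) \<le> (\<Sum>s\<in>{..m} \<union> {Suc m..<Suc m + N}. ?f s)"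
      by (rule sum_mono2) (use f0 in auto)
    also have "\<dots> = (\<Sum>s\<le>m. ?f s) + (\<Sum>s=Suc m..<Suc m + N. ?f s)"
      by (rule sum.union_disjoint) auto
    also have "\<dots> \<le> (\<Sum>s\<le>m. (r * 3 ^ d) ^ s / n) + (\<Sum>s=Suc m..<Suc m + N. r ^ s)"
      by (intro add_mono sum_mono f1 f2)
    also have "\<dots> \<le> (\<Sum>s\<le>m. (r * 3 ^ d) ^ s / n) + r ^ Suc m / (1 - r)"
      by (intro add_left_mono geometric_tail_le r)
    also have "\<dots> \<le> (\<Sum>s\<le>m. (r * 3 ^ d) ^ s) / n + real n powr (- p / d) / (1 - r)"
      using tail r by (auto simp: sum_divide_distrib intro!: divide_right_mono simp del: power_Suc)
    finally show "(\<Sum>s\<le>N. ?f s) \<le> (\<Sum>s\<le>m. (r * 3 ^ d) ^ s) / n + real n powr (- p / d) / (1 - r)" .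
  qed
qed

lemma riemann_zeta_pos:
  assumes "s > 1" shows "riemann_zeta s > 0"
  unfolding riemann_zeta_def
proof (rule suminf_pos)
  have "summable (\<lambda>k. real k powr (- s))" using assms by (subst summable_real_powr_iff) simp
  then show "summable (\<lambda>k. 1 / real (Suc k) powr s)"
    by (subst (asm) summable_Suc_iff[symmetric]) (simp add: powr_minus_divide)
qed simp

lemma rate_powr:
  assumes p: "p \<ge> 1" and d: "d \<ge> 1" and n: "n \<ge> 1"
  shows "rate p d n powr p =
    (if p < d then d / (d - p) * real n powr (- p / d)
     else if p = d then (1 + ln n) / n
     else riemann_zeta (p / d) powr p / n)"
proof -
  have ln: "ln (real n) \<ge> 0" using n by simp
  show ?thesis
  proof (cases "p < d")
    case True
    then show ?thesis using p n
      by (simp only: rate_def if_True powr_mult powr_powr) (simp add: mult.commute)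
  next
    case False
    show ?thesis
    proof (cases "p = d")
      case True
      then show ?thesis using d n ln by (simp add: rate_def powr_powr)
    next
      case False
      with \<open>\<not> p < d\<close> have "riemann_zeta (p / d) > 0"
        using d by (intro riemann_zeta_pos) simp
      then show ?thesis using False \<open>\<not> p < d\<close> p n
        by (simp only: rate_def if_False powr_mult powr_powr) (simp add: powr_minus_divide)
    qed
  qed
qed

lemma rate_pos:
  assumes p: "p \<ge> 1" and d: "d \<ge> 1" and n: "n \<ge> 1"
  shows "rate p d n > 0"
proof -
  have "ln (real n) \<ge> 0" using n by simp
  then have "(1 + ln (real n)) / real n > 0" using n by (intro divide_pos_pos) linarith+
  then show ?thesis
    using p d n riemann_zeta_pos[of "p / d"] by (auto simp: rate_def)
qed

lemma rate_powr_tendsto_0: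
  assumes p: "p \<ge> 1" and d: "d \<ge> 1"
  shows "(\<lambda>n. rate p d n powr p) \<longlonglongrightarrow> 0"
proof -
  have 1: "(\<lambda>n. c * real n powr (- p / d)) \<longlonglongrightarrow> 0" for c
    using p d by (intro tendsto_mult_right_zero tendsto_neg_powr filterlim_real_sequentially) (auto simp: divide_less_0_iff)
  have 2: "(\<lambda>n. (1 + ln (real n)) / real n) \<longlonglongrightarrow> 0"
    using tendsto_add_zero[OF lim_1_over_n[where 'a = real] lim_ln_over_n] by (simp add: add_divide_distrib)
  have 3: "(\<lambda>n. c / real n) \<longlonglongrightarrow> 0" for c
    by (intro tendsto_divide_0[OF tendsto_const] filterlim_at_top_imp_at_infinity filterlim_real_sequentially)
  have "(\<lambda>n. if p < d then d / (d - p) * real n powr (- p / d)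
     else if p = d then (1 + ln n) / n
     else riemann_zeta (p / d) powr p / n) \<longlonglongrightarrow> 0"
    using 1[of "d / (d - p)"] 2 3[of "riemann_zeta (p / d) powr p"]
    by (cases "p < d"; cases "p = d"; simp)
  then show ?thesis
    by (rule Lim_transform_eventually)
      (use eventually_ge_at_top[of 1] in \<open>eventually_elim, simp add: rate_powr[OF p d]\<close>)
qed

text \<open>
  Up to the critical scale the sum is geometric with ratio \<open>a = 3\<^sup>d\<^sup>-\<^sup>p\<close>, and the three regimes of the rate
  correspond to \<open>a > 1\<close>, \<open>a = 1\<close> and \<open>a < 1\<close>: the last term dominates, all terms are
  equal, or the first term dominates.
\<close>

lemma multiscale_sum_le_rate:
  fixes p :: real and d :: nat
  assumes p: "p \<ge> 1" and d: "d \<ge> 1"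
  shows "\<exists>C>0. \<forall>n\<ge>1. \<forall>N.
    (\<Sum>s\<le>N. (1 / 3 ^ s) powr p * min 1 (3 ^ (d * s) / real n)) \<le> C * rate p d n powr p"
proof -
  define r :: real where "r = 3 powr (- p)"
  define a where "a = r * 3 ^ d"
  let ?S = "\<lambda>n N. \<Sum>s\<le>N. (1 / 3 ^ s) powr p * min 1 (3 ^ (d * s) / real n)"
  have r: "0 < r" "r < 1" using p powr_less_mono[of "-p" 0 3] by (auto simp: r_def)
  have a: "a = 3 powr (d - p)" by (simp add: a_def r_def powr_diff powr_minus_divide powr_realpow)
  define T where "T = 1 / (1 - r)"
  have T: "T > 0" using r by (simp add: T_def)
  have "\<forall>n. \<exists>m. n \<ge> 1 \<longrightarrow> (3 ^ d) ^ m \<le> real n \<and>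
      (\<forall>N. ?S n N \<le> (\<Sum>s\<le>m. a ^ s) / real n + T * real n powr (- p / d))"
  proof (intro allI, subst ex_simps, intro impI)
    fix n :: nat assume n: "n \<ge> 1"
    obtain m where "(3 ^ d) ^ m \<le> real n"
      "\<And>N. ?S n N \<le> (\<Sum>s\<le>m. a ^ s) / real n + real n powr (- p / d) / (1 - r)"
      using multiscale_sum_split[OF p d n, folded r_def, folded a_def] by blast
    then show "\<exists>m. (3 ^ d) ^ m \<le> real n \<and>
      (\<forall>N. ?S n N \<le> (\<Sum>s\<le>m. a ^ s) / real n + T * real n powr (- p / d))"
      by (intro exI[of _ m]) (simp add: T_def)
  qed
  from choice[OF this] obtain m where m: "\<And>n. n \<ge> 1 \<Longrightarrow> (3 ^ d) ^ m n \<le> real n"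
    and S: "\<And>n N. n \<ge> 1 \<Longrightarrow> ?S n N \<le> (\<Sum>s\<le>m n. a ^ s) / real n + T * real n powr (- p / d)"
    by blast
  consider "p < d" | "p = d" | "p > d" by linarith
  then show ?thesis
  proof cases
    case 1
    then have a1: "a > 1" unfolding a by simp
    define C where "C = (a / (a - 1) + T) / (d / (d - p))"
    show ?thesis
    proof (intro exI[of _ C] conjI allI impI)
      show "C > 0" unfolding C_def using a1 T 1 p by (intro divide_pos_pos add_pos_pos) auto
      fix n N :: nat assume n: "n \<ge> 1"
      have "(\<Sum>s\<le>m n. a ^ s) = (a ^ Suc (m n) - 1) / (a - 1)"
        using a1 by (subst lessThan_Suc_atMost[symmetric], subst geometric_sum) auto
      also have "\<dots> \<le> a ^ Suc (m n) / (a - 1)" using a1 by (intro divide_right_mono) auto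
      finally have g: "(\<Sum>s\<le>m n. a ^ s) \<le> a / (a - 1) * a ^ m n" by simp
      have "a ^ m n = ((3 ^ d) ^ m n) powr ((d - p) / d)"
        unfolding a using d by (rule power_powr_rescale)
      also have "\<dots> \<le> real n powr ((d - p) / d)"
        using 1 m[OF n] by (intro powr_mono2) auto
      also have "(d - p) / d = 1 + (- p / d)" using d by (simp add: field_simps)
      also have "real n powr (1 + (- p / d)) = real n * real n powr (- p / d)"
        using powr_add[of "real n" 1 "- p / d"] by simp
      finally have "a / (a - 1) * a ^ m n \<le> a / (a - 1) * (real n * real n powr (- p / d))"
        using a1 by (intro mult_left_mono) auto
      with g have "(\<Sum>s\<le>m n. a ^ s) / real n \<le> a / (a - 1) * real n powr (- p / d)"
        using n by (simp add: pos_divide_le_eq mult_ac)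
      with S[OF n, of N] have "?S n N \<le> (a / (a - 1) + T) * real n powr (- p / d)"
        by (simp add: distrib_right)
      also have "\<dots> = C * rate p d n powr p"
        unfolding rate_powr[OF p d n] C_def using 1 p by simp
      finally show "?S n N \<le> C * rate p d n powr p" .
    qed
  next
    case 2
    then have a1: "a = 1" unfolding a by simp
    show ?thesis
    proof (intro exI[of _ "1 + T"] conjI allI impI)
      show "1 + T > 0" using T by simp
      fix n N :: nat assume n: "n \<ge> 1"
      \<comment> \<open>there are \<open>1 + m n\<close> equal terms, and \<open>m n \<le> ln n\<close> since \<open>e \<le> 3\<close>\<close>
      have "exp (real (m n)) = exp 1 ^ m n" by (simp add: exp_of_nat_mult[symmetric])
      also have "\<dots> \<le> (3 ^ d) ^ m n"
        using exp_le d self_le_power[of "3::real" d] by (intro power_mono) auto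
      also note m[OF n]
      finally have mn: "real (m n) \<le> ln (real n)" using n by (subst ln_ge_iff) auto
      then have "(\<Sum>s\<le>m n. a ^ s) / real n \<le> (1 + ln n) / n"
        by (intro divide_right_mono) (auto simp: a1)
      moreover have "T * real n powr (- p / d) \<le> T * ((1 + ln n) / n)"
        using T n 2 d by (intro mult_left_mono) (auto simp: powr_minus_divide divide_right_mono)
      ultimately have "?S n N \<le> (1 + T) * ((1 + ln n) / n)"
        unfolding distrib_right mult_1 using S[OF n, of N] by linarith
      also have "\<dots> = (1 + T) * rate p d n powr p"
        unfolding rate_powr[OF p d n] using 2 by simp
      finally show "?S n N \<le> (1 + T) * rate p d n powr p" .
    qed
  next
    case 3
    then have a1: "a < 1" "a > 0" unfolding a using powr_less_mono[of "d - p" 0 3] by auto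
    have z: "riemann_zeta (p / d) powr p > 0" using riemann_zeta_pos[of "p / d"] 3 d by auto
    define C where "C = (1 / (1 - a) + T) / (riemann_zeta (p / d) powr p)"
    show ?thesis
    proof (intro exI[of _ C] conjI allI impI)
      show "C > 0" unfolding C_def using a1 T z by (intro divide_pos_pos add_pos_pos) auto
      fix n N :: nat assume n: "n \<ge> 1"
      have "(\<Sum>s\<le>m n. a ^ s) \<le> 1 / (1 - a)"
        using geometric_tail_le[of a 0 "Suc (m n)"] a1 by (simp add: atLeast0LessThan lessThan_Suc_atMost)
      then have "(\<Sum>s\<le>m n. a ^ s) / real n \<le> 1 / (1 - a) / n" by (intro divide_right_mono) auto
      moreover have "real n powr (- p / d) \<le> real n powr (- 1)"
        using 3 n d by (intro powr_mono) (auto simp: field_simps)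
      then have "T * real n powr (- p / d) \<le> T / n"
        using T n mult_left_mono[of "real n powr (- p / d)" "1 / n" T] by (simp add: powr_minus_divide)
      ultimately have "?S n N \<le> (1 / (1 - a) + T) / n"
        unfolding add_divide_distrib using S[OF n, of N] by linarith
      also have "\<dots> = C * rate p d n powr p"
        unfolding rate_powr[OF p d n] C_def using 3 z by simp
      finally show "?S n N \<le> C * rate p d n powr p" .
    qed
  qed
qed

section \<open>Choice of the radius\<close>

text \<open>
  The choice \<open>3\<^sup>J \<approx> Y = (\<delta> / G)\<^sup>1\<^sup>/\<^sup>q\<close> turns both terms of the bound into multiples of \<open>G\<^sup>1\<^sup>-\<^sup>p\<^sup>/\<^sup>q\<close>.  The
  first has the factor \<open>\<delta>\<^sup>p\<^sup>/\<^sup>q\<close>, small if \<open>\<delta>\<close> is.  The second has a factor depending on \<open>\<delta>\<close>, times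
  \<open>\<tau> J\<close>, which still tends to 0 because \<open>J \<rightarrow> \<infinity>\<close> as \<open>G \<rightarrow> 0\<close>.
\<close>

lemma eventually_le_balanced:
  fixes G \<tau> cost :: "nat \<Rightarrow> real" and p q C \<epsilon> :: real
  assumes p: "1 \<le> p" "p < q" and C: "C > 0" and \<epsilon>: "\<epsilon> > 0"
    and Gpos: "eventually (\<lambda>n. G n > 0) sequentially" and G0: "G \<longlonglongrightarrow> 0"
    and \<tau>: "\<tau> \<longlonglongrightarrow> 0"
    and bound: "eventually (\<lambda>n. \<forall>J. cost n \<le> C * ((3 ^ J) powr p * G n + (3 ^ J) powr (p - q) * \<tau> J)) sequentially"
  shows "eventually (\<lambda>n. cost n \<le> \<epsilon> * G n powr (1 - p / q)) sequentially"
proof -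
  define \<delta> where "\<delta> = (\<epsilon> / (2 * C)) powr (q / p)"
  have \<delta>: "\<delta> > 0" using \<epsilon> C by (simp add: \<delta>_def)
  have \<delta>p: "\<delta> powr (p / q) = \<epsilon> / (2 * C)" using p \<epsilon> C by (simp add: \<delta>_def powr_powr)
  \<comment> \<open>\<open>A\<close> is the factor of the second term; the power of 3 pays for rounding \<open>Y\<close> down to a power of 3\<close>
  define A where "A = 3 powr (q - p) * \<delta> powr (p / q - 1)"
  have A: "A > 0" using \<delta> by (simp add: A_def)
  define \<eta> where "\<eta> = \<epsilon> / (2 * C * A)"
  have \<eta>: "\<eta> > 0" using \<epsilon> C A by (simp add: \<eta>_def)
  from order_tendstoD(2)[OF \<tau> \<eta>] obtain J0 where J0: "\<And>J. J \<ge> J0 \<Longrightarrow> \<tau> J < \<eta>"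
    by (auto simp: eventually_sequentially)
  \<comment> \<open>below the threshold \<open>g0\<close> the scale \<open>Y\<close> is at least \<open>3\<^sup>J\<^sup>0\<close>\<close>
  define g0 where "g0 = \<delta> / (3 ^ J0) powr q"
  have "g0 > 0" using \<delta> by (simp add: g0_def)
  from order_tendstoD(2)[OF G0 this] Gpos bound show ?thesis
  proof eventually_elim
    case (elim n)
    define Y where "Y = (\<delta> / G n) powr (1 / q)"
    have Gn: "G n > 0" by fact
    have Y0: "Y > 0" using \<delta> Gn by (simp add: Y_def)
    have "(3 ^ J0) powr q < \<delta> / G n"
      using elim(1) Gn by (simp add: g0_def field_simps)
    then have "((3 ^ J0) powr q) powr (1 / q) \<le> Y"
      unfolding Y_def using p by (intro powr_mono2) auto
    then have YJ0: "3 ^ J0 \<le> Y" using p by (simp add: powr_powr)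
    have "1 \<le> Y" using YJ0 one_le_power[of "3::real" J0] by linarith
    then obtain J where J: "3 ^ J \<le> Y" "Y < 3 ^ Suc J"
      using ex_power_interval[of 3 Y] by auto
    have "J \<ge> J0"
    proof (rule ccontr)
      assume "\<not> J \<ge> J0"
      then have "(3::real) ^ Suc J \<le> 3 ^ J0" by (intro power_increasing) auto
      with J YJ0 show False by linarith
    qed
    then have \<tau>J: "\<tau> J \<le> \<eta>" using J0 by (simp add: less_imp_le)
    have Gsplit: "G n = G n powr (p / q) * G n powr (1 - p / q)"
      using Gn by (simp flip: powr_add)
    have "(3 ^ J) powr p * G n \<le> Y powr p * G n"
      using J(1) p Gn by (intro mult_right_mono powr_mono2) auto
    also have "Y powr p = \<delta> powr (p / q) / G n powr (p / q)"
      using \<delta> Gn by (simp add: Y_def powr_powr powr_divide)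
    also have "\<dots> * G n = \<delta> powr (p / q) * G n powr (1 - p / q)"
      using Gn by (subst (2) Gsplit) simp
    finally have t1: "(3 ^ J) powr p * G n \<le> \<epsilon> / (2 * C) * G n powr (1 - p / q)"
      by (simp only: \<delta>p)
    have "(3 ^ J) powr (p - q) \<le> (Y / 3) powr (p - q)"
      using J(2) p Y0 by (intro powr_mono2') auto
    also have "\<dots> = Y powr (p - q) * 3 powr (q - p)"
      using Y0 powr_minus_divide[of 3 "q - p"] by (simp add: powr_divide)
    also have "Y powr (p - q) = (\<delta> / G n) powr (p / q - 1)"
      using p by (simp add: Y_def powr_powr diff_divide_distrib)
    also have "\<dots> = \<delta> powr (p / q - 1) * G n powr (1 - p / q)"
      using \<delta> Gn powr_minus_divide[of "G n" "1 - p / q"] by (simp add: powr_divide)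
    finally have t2: "(3 ^ J) powr (p - q) \<le> A * G n powr (1 - p / q)"
      by (simp add: A_def mult_ac)
    have "(3 ^ J) powr (p - q) * \<tau> J \<le> (3 ^ J) powr (p - q) * \<eta>"
      using \<tau>J by (intro mult_left_mono) auto
    also have "\<dots> \<le> A * G n powr (1 - p / q) * \<eta>"
      using t2 \<eta> by (intro mult_right_mono) auto
    also have "\<dots> = \<epsilon> / (2 * C) * G n powr (1 - p / q)"
      using A C by (simp add: \<eta>_def)
    finally have "(3 ^ J) powr p * G n + (3 ^ J) powr (p - q) * \<tau> J \<le> \<epsilon> / C * G n powr (1 - p / q)"
      using t1 by (simp add: field_simps)
    then have "C * ((3 ^ J) powr p * G n + (3 ^ J) powr (p - q) * \<tau> J) \<le> C * (\<epsilon> / C * G n powr (1 - p / q))"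
      using C by (intro mult_left_mono) auto
    also have "\<dots> = \<epsilon> * G n powr (1 - p / q)" using C by simp
    finally show ?case using elim(3)[rule_format, of J] by linarith
  qed
qed

lemma tail_moment_tendsto_0:
  fixes \<rho> :: "(real ^ 'd) measure" and q :: real
  assumes sets: "sets \<rho> = sets borel" and int: "integrable \<rho> (\<lambda>x. infnorm x powr q)"
  shows "(\<lambda>J::nat. \<integral>x. indicator {x. 3 ^ J / 2 \<le> infnorm x} x * infnorm x powr q \<partial>\<rho>) \<longlonglongrightarrow> 0"
proof -
  note [measurable_cong] = sets
  have "(\<lambda>J::nat. \<integral>x. indicator {x. 3 ^ J / 2 \<le> infnorm x} x * infnorm x powr q \<partial>\<rho>)
      \<longlonglongrightarrow> (\<integral>x. 0 \<partial>\<rho>)"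
  proof (rule integral_dominated_convergence[OF _ _ int])
    show "AE x in \<rho>. (\<lambda>J. indicator {x. 3 ^ J / 2 \<le> infnorm x} x * infnorm x powr q) \<longlonglongrightarrow> 0"
    proof (intro AE_I2 tendsto_eventually)
      fix x :: "real ^ 'd"
      obtain J0 where J0: "2 * infnorm x < 3 ^ J0"
        using real_arch_pow[of 3 "2 * infnorm x"] by auto
      show "eventually (\<lambda>J. indicator {x. 3 ^ J / 2 \<le> infnorm x} x * infnorm x powr q = 0) sequentially"
        using eventually_ge_at_top[of J0]
      proof eventually_elim
        case (elim J)
        then have "(3::real) ^ J0 \<le> 3 ^ J" by (intro power_increasing) auto
        with J0 have "2 * infnorm x < 3 ^ J" by (rule less_le_trans)
        then have "\<not> 3 ^ J / 2 \<le> infnorm x" by simp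
        then show ?case by simp
      qed
    qed
    show "AE x in \<rho>. norm (indicator {x. 3 ^ J / 2 \<le> infnorm x} x * infnorm x powr q) \<le> infnorm x powr q" for J :: nat
      by (auto simp: indicator_def)
  qed measurable
  then show ?thesis by simp
qed

theorem corollary3p5:
  fixes \<rho> :: "(real ^ 'd) measure" and q :: real
  assumes "q \<ge> 1"
    and "prob_space \<rho>" and "sets \<rho> = sets borel"
    and "integrable \<rho> (\<lambda>x. infnorm x powr q)"
  shows "\<exists>x :: nat \<Rightarrow> nat \<Rightarrow> real ^ 'd. \<forall>p. 1 \<le> p \<and> p < q \<longrightarrow>
    (\<lambda>n. wasserstein p (empirical_measure n (x n)) \<rho>)
      \<in> o(\<lambda>n. rate p CARD('d) n powr (1 - p / q))"
proof -
  define \<tau> where "\<tau> J = (\<integral>x. indicator {x. 3 ^ J / 2 \<le> infnorm x} x * infnorm x powr q \<partial>\<rho>)" for J :: nat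
  have \<tau>: "\<tau> \<longlonglongrightarrow> 0" unfolding \<tau>_def by (rule tail_moment_tendsto_0) fact+
  have \<tau>0: "\<tau> J \<ge> 0" for J unfolding \<tau>_def by (rule Bochner_Integration.integral_nonneg) simp
  let ?d = "CARD('d)"
  let ?M = "\<lambda>p n J. \<Sum>s\<le>n + J. (1 / 3 ^ s) powr p * min 1 (3 ^ (?d * s) / real n)"
  have d: "?d \<ge> 1" by (simp add: Suc_le_eq)
  have "\<forall>n. \<exists>y :: nat \<Rightarrow> real ^ 'd. n > 0 \<longrightarrow> (\<forall>p J. 1 \<le> p \<and> p < q \<longrightarrow>
    transport_cost p (empirical_measure n y) \<rho> \<le> ennreal (
      3 ^ ?d * (3 ^ J) powr p * ?M p n J + 6 powr p * (3 ^ J / 2) powr (p - q) * \<tau> J))"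
    using quantization_cost_bound[OF assms(2,3,4), folded \<tau>_def] by blast
  from choice[OF this] obtain x :: "nat \<Rightarrow> nat \<Rightarrow> real ^ 'd" where
    x: "\<And>n p J. n > 0 \<Longrightarrow> 1 \<le> p \<Longrightarrow> p < q \<Longrightarrow>
      transport_cost p (empirical_measure n (x n)) \<rho> \<le> ennreal (
        3 ^ ?d * (3 ^ J) powr p * ?M p n J + 6 powr p * (3 ^ J / 2) powr (p - q) * \<tau> J)"
    by blast
  show ?thesis
  proof (intro exI[of _ x] allI impI, elim conjE, rule landau_o.smallI)
    fix p c :: real assume p: "1 \<le> p" "p < q" and c: "c > 0"
    define G where "G n = rate p ?d n powr p" for n
    define cost where "cost n = enn2real (transport_cost p (empirical_measure n (x n)) \<rho>)" for n
    obtain C0 where C0: "C0 > 0" and M: "\<forall>n\<ge>1. \<forall>N.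
        (\<Sum>s\<le>N. (1 / 3 ^ s) powr p * min 1 (3 ^ (?d * s) / real n)) \<le> C0 * G n"
      using multiscale_sum_le_rate[OF p(1) d] unfolding G_def by (elim exE conjE)
    define C where "C = 3 ^ ?d * C0 + 6 powr p * 2 powr (q - p)"
    have C: "C > 0" using C0 by (auto simp: C_def intro!: add_pos_pos)
    have Gpos: "G n > 0" if "n \<ge> 1" for n
      using rate_pos[OF p(1) d that] by (simp add: G_def)
    have bound: "cost n \<le> C * ((3 ^ J) powr p * G n + (3 ^ J) powr (p - q) * \<tau> J)" if n: "n \<ge> 1" for n J
    proof -
      let ?a = "(3 ^ J) powr p * G n" and ?b = "(3 ^ J) powr (p - q) * \<tau> J"
      have ab: "?a \<ge> 0" "?b \<ge> 0" using Gpos[OF n] \<tau>0 by simp_all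
      have "(3 ^ J / 2) powr (p - q) = (3 ^ J) powr (p - q) * 2 powr (q - p)"
        using powr_minus_divide[of 2 "q - p"] by (simp add: powr_divide)
      then have "3 ^ ?d * (3 ^ J) powr p * ?M p n J + 6 powr p * (3 ^ J / 2) powr (p - q) * \<tau> J
          = 3 ^ ?d * (3 ^ J) powr p * ?M p n J + 6 powr p * 2 powr (q - p) * ?b"
        by simp
      also have "\<dots> \<le> 3 ^ ?d * (3 ^ J) powr p * (C0 * G n) + 6 powr p * 2 powr (q - p) * ?b"
        using M[rule_format, OF n, of "n + J"] by (intro add_right_mono mult_left_mono) auto
      also have "\<dots> = 3 ^ ?d * C0 * ?a + 6 powr p * 2 powr (q - p) * ?b" by simp
      also have "\<dots> \<le> C * ?a + C * ?b"
        using ab C0 by (intro add_mono mult_right_mono) (auto simp: C_def)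
      finally have "transport_cost p (empirical_measure n (x n)) \<rho> \<le> ennreal (C * (?a + ?b))"
        using n p by (intro order_trans[OF x[of n p J]] ennreal_leI) (auto simp: distrib_left)
      then show ?thesis unfolding cost_def
        using ab C by (intro enn2real_leI) auto
    qed
    have "eventually (\<lambda>n. cost n \<le> c powr p * G n powr (1 - p / q)) sequentially"
    proof (rule eventually_le_balanced[OF p C])
      show "c powr p > 0" using c by simp
      show "G \<longlonglongrightarrow> 0" unfolding G_def using p(1) d by (rule rate_powr_tendsto_0)
      show "eventually (\<lambda>n. G n > 0) sequentially"
        using eventually_ge_at_top[of 1] by eventually_elim (rule Gpos)
      show "eventually (\<lambda>n. \<forall>J. cost n \<le> C * ((3 ^ J) powr p * G n + (3 ^ J) powr (p - q) * \<tau> J)) sequentially"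
        using eventually_ge_at_top[of 1] by eventually_elim (use bound in blast)
    qed (rule \<tau>)
    then show "eventually (\<lambda>n. norm (wasserstein p (empirical_measure n (x n)) \<rho>)
        \<le> c * norm (rate p ?d n powr (1 - p / q))) sequentially"
      using eventually_ge_at_top[of 1]
    proof eventually_elim
      case (elim n)
      have r: "rate p ?d n > 0" using rate_pos[OF p(1) d elim(2)] .
      have "wasserstein p (empirical_measure n (x n)) \<rho> = cost n powr (1 / p)"
        by (simp add: wasserstein_def cost_def)
      also have "\<dots> \<le> (c powr p * G n powr (1 - p / q)) powr (1 / p)"
        using elim(1) p by (intro powr_mono2) (auto simp: cost_def)
      also have "\<dots> = c * rate p ?d n powr (1 - p / q)"
        using p c r by (simp add: G_def powr_mult powr_powr)
      finally show ?case by (simp add: wasserstein_def)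
    qed
  qed
qed

end
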